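(* There is no four-stage explicit Runge--Kutta method of classical order four with positive SSP coefficient. In contrast, four-stage explicit Runge--Kutta methods with positive SSP coefficient and effective order four have been found by numerical optimization, both with classical order $p=2$ and with classical order $p=3$. Their coefficients (printed to 15 decimals; unlisted $a_{ij}$ are zero) are as follows. (i) Method of effective order four and classical order two, called ESSPRK(4,4,2): $a_{21}=0.730429885783319$; $a_{31}=0.251830917810810$, $a_{32}=0.393133720334985$; $a_{41}=0.141062771617064$, $a_{42}=0.220213358584678$, $a_{43}=0.638723869798257$; $b_1=0.384422161080494$, $b_2=0.261154113377550$, $b_3=0.127250689937518$, $b_4=0.227173035604438$; $c_1=0$, $c_2=0.730429885783319$, $c_3=0.644964638145795$, $c_4=1.000000000000000$. (ii) Method of effective order four and classical order three, called ESSPRK(4,4,3): $a_{21}=0.601245068769724$; $a_{31}=0.139346829159954$, $a_{32}=0.297541890726109$; $a_{41}=0.060555450075478$, $a_{42}=0.129301708677891$, $a_{43}=0.557903005003740$; $b_1=0.220532078662434$, $b_2=0.180572397883936$, $b_3=0.181420582644840$, $b_4=0.417474940808790$; $c_1=0$, $c_2=0.601245068769724$, $c_3=0.436888719886063$, $c_4=0.747760163757110$.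
   Context: Runge--Kutta methods. An $s$-stage Runge--Kutta method is given by real coefficients $A=(a_{ij})\in\mathbb{R}^{s\times s}$, $\bm{b}\in\mathbb{R}^s$, with $c_i=\sum_j a_{ij}$; it is explicit if $a_{ij}=0$ for $j\ge i$. For $\bm{u}'=\bm{F}(\bm{u})$ it computes $\bm{Y}_i=\bm{u}^n+\Delta t\sum_j a_{ij}\bm{F}(\bm{Y}_j)$ and $\bm{u}^{n+1}=\bm{u}^n+\Delta t\sum_i b_i\bm{F}(\bm{Y}_i)$. SSP (strong stability preserving) coefficient. Let $K$ be the $(s+1)\times s$ matrix whose first $s$ rows are $A$ and whose last row is $\bm{b}^T$, and let $\bm{e}_m$ be the vector of ones of length $m$. The SSP coefficient of the method is the largest $r\ge 0$ such that $I+rA$ is invertible and, componentwise, $$K(I+rA)^{-1}\ge 0,\qquad \bm{e}_{s+1}-rK(I+rA)^{-1}\bm{e}_s\ge 0;$$ it is positive if these conditions hold for some $r>0$. Elementary weights. Let $r(t)$ be the number of vertices of a rooted tree $t$. Write $t=[t_1,\dots,t_m]$ for the tree obtained by joining the roots of $t_1,\dots,t_m$ to a new root; the single-vertex tree is $[\,]$. For a Runge--Kutta method put $D_i([t_1,\dots,t_m])=\prod_{k=1}^m\sum_j a_{ij}D_j(t_k)$ (empty product $=1$). Its elementary weight is $\alpha(t)=\sum_i b_iD_i(t)$, with $\alpha(\emptyset)=1$ for the empty tree. Butcher group $G$. $G$ is the set of real functions on rooted trees (including $\emptyset$) taking value $1$ at $\emptyset$, with product $$(\alpha\beta)(t)=\sum_{u}\beta(u)\prod_{t'\in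 t\setminus u}\alpha(t'),$$ where $u$ ranges over the empty tree and all subtrees of $t$ (connected vertex subsets) containing the root of $t$, and $t\setminus u$ is the forest of rooted trees left after deleting $u$ from $t$ (for $u=\emptyset$ it is $\{t\}$). The product $\alpha\beta$ corresponds to applying the method of $\alpha$ first and then the method of $\beta$. The identity $1\in G$ is $1$ at $\emptyset$ and $0$ at every nonempty tree. The exact evolution $E\in G$ is $E(\emptyset)=1$ and $E(t)=1/\gamma(t)$ for nonempty $t$, where $\gamma([t_1,\dots,t_m])=r(t)\prod_k\gamma(t_k)$. Orders. A Runge--Kutta method with corresponding $\alpha\in G$ has classical order $p$ if $\alpha(t)=E(t)$ for every tree with $r(t)\le p$ (so a method of classical order $p+1$ also has classical order $p$). It has effective order $q$ if there exist Runge--Kutta methods $S$ and $S^{-1}$ with corresponding elements $\beta,\beta^{-1}\in G$ such that $(\beta^{-1}\beta)(t)=1(t)$ and $(\beta\alpha\beta^{-1})(t)=E(t)$ for every tree $t$ with $r(t)\le q$. The coefficients come from a numerical search and are decimal values, so the order conditions hold for them up to rounding. *)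

theory Defs
  imports
    "Jordan_Normal_Form.Matrix"
    "HOL-Library.Multiset"
    "HOL-Library.Extended_Real"
begin

section \<open>Runge--Kutta methods\<close>

text \<open>A method is given by its coefficients \<open>A\<close> and \<open>b\<close>. Stages are numbered from 0, so the entry
  \<open>A $$ (i, j)\<close> is the coefficient usually printed with the indices \<open>i + 1\<close> and \<open>j + 1\<close>.\<close>

definition rk_method :: "nat \<Rightarrow> real mat \<Rightarrow> real vec \<Rightarrow> bool" where
  "rk_method s A b \<longleftrightarrow> A \<in> carrier_mat s s \<and> b \<in> carrier_vec s"

definition rk_explicit :: "real mat \<Rightarrow> bool" where
  "rk_explicit A \<longleftrightarrow> (\<forall>i<dim_row A. \<forall>j<dim_col A. i \<le> j \<longrightarrow> A $$ (i, j) = 0)"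

definition abscissa :: "real mat \<Rightarrow> nat \<Rightarrow> real" where
  "abscissa A i = (\<Sum>j<dim_col A. A $$ (i, j))"


section \<open>SSP coefficient\<close>

definition ones :: "nat \<Rightarrow> real vec" where
  "ones m = vec m (\<lambda>_. 1)"

definition K_mat :: "real mat \<Rightarrow> real vec \<Rightarrow> real mat" where
  "K_mat A b = mat (dim_vec b + 1) (dim_vec b)
     (\<lambda>(i, j). if i < dim_vec b then A $$ (i, j) else b $ j)"

definition ssp_conditions :: "real mat \<Rightarrow> real vec \<Rightarrow> real \<Rightarrow> bool" where
  "ssp_conditions A b r \<longleftrightarrow>
     (let s = dim_vec b; M = 1\<^sub>m s + r \<cdot>\<^sub>m A in
      \<exists>N \<in> carrier_mat s s. inverts_mat M N \<and> inverts_mat N M \<and>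
        0\<^sub>m (s + 1) s \<le> K_mat A b * N \<and>
        0\<^sub>v (s + 1) \<le> ones (s + 1) - r \<cdot>\<^sub>v ((K_mat A b * N) *\<^sub>v ones s))"

text \<open>The admissible \<open>r\<close> can be unbounded (implicit Euler) or fail to exist at all (negative
  coefficients); the supremum in \<^typ>\<open>ereal\<close> is then \<open>\<infinity>\<close> and \<open>- \<infinity>\<close>, respectively. It is positive
  iff the conditions hold for some \<open>r > 0\<close>.\<close>

definition ssp_coefficient :: "real mat \<Rightarrow> real vec \<Rightarrow> ereal" where
  "ssp_coefficient A b = Sup (ereal ` {r. 0 \<le> r \<and> ssp_conditions A b r})"


section \<open>Rooted trees and elementary weights\<close>

text \<open>\<open>Node {#t1, \<dots>, tm#}\<close> is the tree \<open>[t1, \<dots>, tm]\<close>. Functions on trees that are also defined at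
  the empty tree take an argument of type \<open>rtree option\<close>, with \<open>None\<close> as the empty tree.\<close>

datatype rtree = Node "rtree multiset"

primrec tree_size :: "rtree \<Rightarrow> nat" where
  "tree_size (Node ts) = 1 + (\<Sum>t\<in>#ts. tree_size t)"

primrec tree_density :: "rtree \<Rightarrow> nat" where
  "tree_density (Node ts) = tree_size (Node ts) * (\<Prod>t\<in>#ts. tree_density t)"

fun num_vertices :: "rtree option \<Rightarrow> nat" where
  "num_vertices None = 0"
| "num_vertices (Some t) = tree_size t"

primrec stage_weight :: "real mat \<Rightarrow> rtree \<Rightarrow> nat \<Rightarrow> real" where
  "stage_weight A (Node ts) =
     (\<lambda>i. \<Prod>t\<in>#ts. \<Sum>j<dim_col A. A $$ (i, j) * stage_weight A t j)"

fun elementary_weight :: "real mat \<Rightarrow> real vec \<Rightarrow> rtree option \<Rightarrow> real" where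
  "elementary_weight A b None = 1"
| "elementary_weight A b (Some t) = (\<Sum>i<dim_vec b. b $ i * stage_weight A t i)"


section \<open>Butcher group\<close>

text \<open>\<open>cuts t\<close> contains one pair \<open>(u, t \ u)\<close> for every connected vertex subset \<open>u\<close> of \<open>t\<close> containing
  the root, hence a repeated pair where different subsets give isomorphic results. Such a subset
  is chosen branch by branch: either the whole branch is deleted, or a connected subset containing
  the root of the branch is kept. The pairs handled by \<open>branch_sum\<close> consist of the kept parts and
  the deleted trees of some of the branches.\<close>

definition branch_sum ::
  "('a multiset \<times> 'b multiset) multiset \<Rightarrow> ('a multiset \<times> 'b multiset) multiset \<Rightarrow>
   ('a multiset \<times> 'b multiset) multiset" where
  "branch_sum M N = (\<Sum>(us, f)\<in>#M. image_mset (\<lambda>(vs, g). (us + vs, f + g)) N)"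

primrec cuts :: "rtree \<Rightarrow> (rtree \<times> rtree multiset) multiset" where
  "cuts (Node ts) =
     image_mset (\<lambda>(us, f). (Node us, f))
       (fold_mset branch_sum {#({#}, {#})#}
         (image_mset (\<lambda>t. add_mset ({#}, {#t#}) (image_mset (\<lambda>(u, f). ({#u#}, f)) (cuts t))) ts))"

fun butcher_prod ::
  "(rtree option \<Rightarrow> real) \<Rightarrow> (rtree option \<Rightarrow> real) \<Rightarrow> rtree option \<Rightarrow> real" where
  "butcher_prod \<alpha> \<beta> None = \<beta> None"
| "butcher_prod \<alpha> \<beta> (Some t) =
     \<beta> None * \<alpha> (Some t) + (\<Sum>(u, f)\<in>#cuts t. \<beta> (Some u) * (\<Prod>t'\<in>#f. \<alpha> (Some t')))"

fun butcher_one :: "rtree option \<Rightarrow> real" where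
  "butcher_one None = 1"
| "butcher_one (Some t) = 0"

fun exact_evolution :: "rtree option \<Rightarrow> real" where
  "exact_evolution None = 1"
| "exact_evolution (Some t) = 1 / real (tree_density t)"


section \<open>Orders\<close>

definition classical_order :: "nat \<Rightarrow> real mat \<Rightarrow> real vec \<Rightarrow> bool" where
  "classical_order p A b \<longleftrightarrow>
     (\<forall>t. num_vertices t \<le> p \<longrightarrow> elementary_weight A b t = exact_evolution t)"

definition effective_order :: "nat \<Rightarrow> real mat \<Rightarrow> real vec \<Rightarrow> bool" where
  "effective_order q A b \<longleftrightarrow>
     (\<exists>s A\<^sub>S b\<^sub>S s' A\<^sub>S' b\<^sub>S'. rk_method s A\<^sub>S b\<^sub>S \<and> rk_method s' A\<^sub>S' b\<^sub>S' \<and>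
       (let \<alpha> = elementary_weight A b;
            \<beta> = elementary_weight A\<^sub>S b\<^sub>S;
            \<beta>' = elementary_weight A\<^sub>S' b\<^sub>S'
        in \<forall>t. num_vertices t \<le> q \<longrightarrow>
             butcher_prod \<beta>' \<beta> t = butcher_one t \<and>
             butcher_prod (butcher_prod \<beta> \<alpha>) \<beta>' t = exact_evolution t))"


section \<open>Agreement with printed coefficients\<close>

text \<open>\<open>A'\<close> (by rows), \<open>b'\<close>, \<open>c'\<close> are decimal values, each meant to be within \<open>\<epsilon>\<close> of the exact
  coefficient.\<close>

definition tableau_within ::
  "real \<Rightarrow> real mat \<Rightarrow> real vec \<Rightarrow> real list list \<Rightarrow> real list \<Rightarrow> real list \<Rightarrow> bool" where
  "tableau_within \<epsilon> A b A' b' c' \<longleftrightarrow>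
     (\<forall>i<dim_vec b. \<bar>b $ i - b' ! i\<bar> \<le> \<epsilon> \<and> \<bar>abscissa A i - c' ! i\<bar> \<le> \<epsilon> \<and>
        (\<forall>j<dim_vec b. \<bar>A $$ (i, j) - A' ! i ! j\<bar> \<le> \<epsilon>))"

text \<open>The decimals carry the rounding errors of a numerical search. The order conditions have an
  exact solution within half a unit of the 15th decimal of \<open>essprk442\<close>, but the nearest one to
  \<open>essprk443\<close> is about 0.96 units away, so a whole unit is allowed there. As \<open>tableau_within\<close> does
  not exclude nonzero unlisted coefficients, it is to be combined with \<open>rk_explicit\<close>.\<close>

definition essprk442 :: "real mat \<Rightarrow> real vec \<Rightarrow> bool" where
  "essprk442 A b \<longleftrightarrow> tableau_within (1 / 2 / 10 ^ 15) A b
     [[0, 0, 0, 0],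
      [0.730429885783319, 0, 0, 0],
      [0.251830917810810, 0.393133720334985, 0, 0],
      [0.141062771617064, 0.220213358584678, 0.638723869798257, 0]]
     [0.384422161080494, 0.261154113377550, 0.127250689937518, 0.227173035604438]
     [0, 0.730429885783319, 0.644964638145795, 1.000000000000000]"

definition essprk443 :: "real mat \<Rightarrow> real vec \<Rightarrow> bool" where
  "essprk443 A b \<longleftrightarrow> tableau_within (1 / 10 ^ 15) A b
     [[0, 0, 0, 0],
      [0.601245068769724, 0, 0, 0],
      [0.139346829159954, 0.297541890726109, 0, 0],
      [0.060555450075478, 0.129301708677891, 0.557903005003740, 0]]
     [0.220532078662434, 0.180572397883936, 0.181420582644840, 0.417474940808790]
     [0, 0.601245068769724, 0.436888719886063, 0.747760163757110]"

end

theory Submission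
  imports Defs "Jordan_Normal_Form.Determinant"
begin

text \<open>For an explicit four-stage method of order four, a determinant argument gives the simplifying
  assumption \<open>\<Sum>\<^sub>i b\<^sub>i a\<^sub>i\<^sub>j = b\<^sub>j (1 - c\<^sub>j)\<close>, hence \<open>c\<^sub>4 = 1\<close>. A positive SSP coefficient forces nonnegative
  coefficients and moreover \<open>a\<^sub>3\<^sub>1, a\<^sub>4\<^sub>2 > 0\<close>. Nonnegativity of \<open>b\<^sub>2, b\<^sub>3\<close> places \<open>c\<^sub>2, c\<^sub>3\<close> on opposite
  sides of \<open>1/2\<close> or both at \<open>1/2\<close>. If \<open>c\<^sub>2 \<le> c\<^sub>3\<close>, then \<open>a\<^sub>3\<^sub>1\<close> and \<open>a\<^sub>4\<^sub>2\<close> cannot both be positive;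
  if \<open>c\<^sub>3 < c\<^sub>2\<close>, then \<open>a\<^sub>4\<^sub>1 < 0\<close>.

  Effective order four amounts to five equations in the elementary weights \<open>\<alpha>\<close> of the method alone,
  because the conjugating element \<open>\<beta>\<close> enters only through its values on the trees with two and three
  vertices, which can be prescribed by a four-stage method. Given \<open>c\<^sub>2, c\<^sub>3, c\<^sub>4\<close> and \<open>m = b\<^sub>4 a\<^sub>4\<^sub>3\<close>,
  these equations are linear in \<open>b\<close> and \<open>b\<^sub>4 a\<^sub>4\<^sub>2\<close>. They therefore have rational solutions, and suitable
  ones lie within the printed precision.\<close>

section \<open>Products on trees with at most four vertices\<close>

lemma branch_sum_simps:
  "branch_sum (add_mset (us, f) M) N = image_mset (\<lambda>(vs, g). (us + vs, f + g)) N + branch_sum M N"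
  "branch_sum {#} N = {#}"
  by (simp_all add: branch_sum_def)

lemma branch_sum_union_right: "branch_sum M (N + N') = branch_sum M N + branch_sum M N'"
  by (induction M) (auto simp: branch_sum_simps ac_simps)

lemma branch_sum_image:
  "branch_sum M (image_mset (\<lambda>(vs, g). (us + vs, f + g)) N) =
   image_mset (\<lambda>(vs, g). (us + vs, f + g)) (branch_sum M N)"
  by (induction M)
     (auto simp: branch_sum_simps multiset.map_comp intro!: image_mset_cong simp: ac_simps)

text \<open>\<open>fold_mset\<close> unfolds along \<open>add_mset\<close> only for a commuting
  operation, so this makes \<open>cuts\<close> computable on explicit trees.\<close>

interpretation branch_sum: comp_fun_commute branch_sum
proof (unfold_locales, rule ext)
  fix M N X
  show "(branch_sum M \<circ> branch_sum N) X = (branch_sum N \<circ> branch_sum M) X"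
    by (induction M)
       (auto simp: branch_sum_simps branch_sum_image branch_sum_union_right
             intro: sym[OF branch_sum_image] simp: branch_sum_def[of N "{#}"])
qed

section \<open>Enumeration of the rooted trees with at most four vertices\<close>

abbreviation "t1 \<equiv> Node {#}"
abbreviation "t2 \<equiv> Node {#t1#}"
abbreviation "t3 \<equiv> Node {#t1, t1#}"
abbreviation "t4 \<equiv> Node {#t2#}"
abbreviation "t5 \<equiv> Node {#t1, t1, t1#}"
abbreviation "t6 \<equiv> Node {#t1, t2#}"
abbreviation "t7 \<equiv> Node {#t3#}"
abbreviation "t8 \<equiv> Node {#t4#}"

lemma tree_size_pos: "0 < tree_size t"
  by (cases t) simp

text \<open>The enumeration alternates between trees and forests: a tree with n + 1 vertices is a
  forest with n vertices under a root, and a nonempty forest splits off one tree.\<close>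

definition forest_size :: "rtree multiset \<Rightarrow> nat" where
  "forest_size ts = (\<Sum>t\<in>#ts. tree_size t)"

lemma forest_size_simps [simp]:
  "forest_size {#} = 0"
  "forest_size (add_mset t ts) = tree_size t + forest_size ts"
  by (simp_all add: forest_size_def)

lemma tree_size_Node_eq: "tree_size (Node ts) = Suc n \<longleftrightarrow> forest_size ts = n"
  by (simp add: forest_size_def)

lemma forest_size_0: "forest_size ts = 0 \<Longrightarrow> ts = {#}"
  using tree_size_pos by (cases ts) (simp_all add: neq0_conv[symmetric] del: neq0_conv)

lemma forest_size_Suc:
  assumes "forest_size ts = Suc n"
  obtains t us where "ts = add_mset t us" "tree_size t + forest_size us = Suc n" "0 < tree_size t"
  using assms tree_size_pos by (cases ts) auto

lemma tree_size_1: "tree_size t = 1 \<Longrightarrow> t = t1"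
  using forest_size_0 tree_size_Node_eq[of _ 0] by (cases t) (auto simp del: tree_size.simps)

lemma forest_size_1:
  assumes "forest_size ts = 1" shows "ts = {#t1#}"
proof -
  obtain t us where ts: "ts = add_mset t us"
    "tree_size t + forest_size us = Suc 0" "0 < tree_size t"
    using assms forest_size_Suc[of ts 0] by auto
  then have "tree_size t = 1" "forest_size us = 0" by auto
  then show ?thesis using ts(1) tree_size_1 forest_size_0 by blast
qed

lemma tree_size_2: "tree_size t = 2 \<Longrightarrow> t = t2"
  using forest_size_1 tree_size_Node_eq[of _ 1]
  by (cases t) (auto simp del: tree_size.simps simp: eval_nat_numeral)

lemma forest_size_2:
  assumes "forest_size ts = 2" shows "ts \<in> {{#t1, t1#}, {#t2#}}"
proof -
  obtain t us where ts: "ts = add_mset t us"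
    "tree_size t + forest_size us = Suc 1" "0 < tree_size t"
    using assms forest_size_Suc[of ts 1] by auto
  then consider "tree_size t = 1" "forest_size us = 1" | "tree_size t = 2" "forest_size us = 0"
    by linarith
  then show ?thesis
    by cases (use ts(1) tree_size_1 tree_size_2 forest_size_0 forest_size_1 in blast)+
qed

lemma tree_size_3: "tree_size t = 3 \<Longrightarrow> t \<in> {t3, t4}"
  using forest_size_2 tree_size_Node_eq[of _ 2]
  by (cases t) (auto simp del: tree_size.simps simp: eval_nat_numeral)

lemma forest_size_3:
  assumes "forest_size ts = 3"
  shows "ts \<in> {{#t1, t1, t1#}, {#t1, t2#}, {#t3#}, {#t4#}}"
proof -
  obtain t us where ts: "ts = add_mset t us"
    "tree_size t + forest_size us = Suc 2" "0 < tree_size t"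
    using assms forest_size_Suc[of ts 2] by auto
  then consider "tree_size t = 1" "forest_size us = 2" | "tree_size t = 2" "forest_size us = 1"
    | "tree_size t = 3" "forest_size us = 0"
    by linarith
  then show ?thesis
    by cases (use ts(1) tree_size_1[of t] tree_size_2[of t] tree_size_3[of t] forest_size_0[of us]
      forest_size_1[of us] forest_size_2[of us] in \<open>auto simp: add_mset_commute\<close>)
qed

lemma tree_size_4: "tree_size t = 4 \<Longrightarrow> t \<in> {t5, t6, t7, t8}"
  using forest_size_3 tree_size_Node_eq[of _ 3]
  by (cases t) (auto simp del: tree_size.simps simp: eval_nat_numeral)

lemma all_tree_size_le_4:
  "(\<forall>t. num_vertices t \<le> 2 \<longrightarrow> P t) \<longleftrightarrow> (P None \<and> P (Some t1) \<and> P (Some t2))"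
  "(\<forall>t. num_vertices t \<le> 3 \<longrightarrow> P t) \<longleftrightarrow> (P None \<and> P (Some t1) \<and> P (Some t2) \<and>
     P (Some t3) \<and> P (Some t4))"
  "(\<forall>t. num_vertices t \<le> 4 \<longrightarrow> P t) \<longleftrightarrow> (P None \<and> P (Some t1) \<and> P (Some t2) \<and>
     P (Some t3) \<and> P (Some t4) \<and> P (Some t5) \<and> P (Some t6) \<and> P (Some t7) \<and> P (Some t8))"
proof -
  have *: "num_vertices t = 0 \<longleftrightarrow> t = None" for t
    using tree_size_pos by (cases t) auto
  have 1: "num_vertices t = 1 \<longleftrightarrow> t = Some t1" for t
    using tree_size_1 by (cases t) auto
  have 2: "num_vertices t = 2 \<longleftrightarrow> t = Some t2" for t
    using tree_size_2 by (cases t) auto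
  have 3: "num_vertices t = 3 \<longleftrightarrow> t = Some t3 \<or> t = Some t4" for t
    using tree_size_3 by (cases t) auto
  have 4: "num_vertices t = 4 \<longleftrightarrow> t = Some t5 \<or> t = Some t6 \<or> t = Some t7 \<or> t = Some t8" for t
    using tree_size_4 by (cases t) auto
  have le: "n \<le> 2 \<longleftrightarrow> n = 0 \<or> n = 1 \<or> n = 2" "n \<le> 3 \<longleftrightarrow> n = 0 \<or> n = 1 \<or> n = 2 \<or> n = 3"
    "n \<le> 4 \<longleftrightarrow> n = 0 \<or> n = 1 \<or> n = 2 \<or> n = 3 \<or> n = 4" for n :: nat
    by auto
  show "(\<forall>t. num_vertices t \<le> 2 \<longrightarrow> P t) \<longleftrightarrow> (P None \<and> P (Some t1) \<and> P (Some t2))"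
    unfolding le * 1 2 by blast
  show "(\<forall>t. num_vertices t \<le> 3 \<longrightarrow> P t) \<longleftrightarrow> (P None \<and> P (Some t1) \<and> P (Some t2) \<and>
     P (Some t3) \<and> P (Some t4))"
    unfolding le * 1 2 3 by blast
  show "(\<forall>t. num_vertices t \<le> 4 \<longrightarrow> P t) \<longleftrightarrow> (P None \<and> P (Some t1) \<and> P (Some t2) \<and>
     P (Some t3) \<and> P (Some t4) \<and> P (Some t5) \<and> P (Some t6) \<and> P (Some t7) \<and> P (Some t8))"
    unfolding le * 1 2 3 4 by blast
qed

text \<open>The summands list the cuts of each tree, the first one belonging to the empty subset;
  the factors 2 and 3 count cuts with isomorphic results.\<close>

lemma butcher_prod_trees:
  assumes "\<beta> None = 1"
  shows "butcher_prod \<alpha> \<beta> (Some t1) = \<alpha> (Some t1) + \<beta> (Some t1)"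
    "butcher_prod \<alpha> \<beta> (Some t2) = \<alpha> (Some t2) + \<beta> (Some t1) * \<alpha> (Some t1) + \<beta> (Some t2)"
    "butcher_prod \<alpha> \<beta> (Some t3) = \<alpha> (Some t3) + \<beta> (Some t1) * \<alpha> (Some t1) ^ 2
       + 2 * \<beta> (Some t2) * \<alpha> (Some t1) + \<beta> (Some t3)"
    "butcher_prod \<alpha> \<beta> (Some t4) = \<alpha> (Some t4) + \<beta> (Some t1) * \<alpha> (Some t2)
       + \<beta> (Some t2) * \<alpha> (Some t1) + \<beta> (Some t4)"
    "butcher_prod \<alpha> \<beta> (Some t5) = \<alpha> (Some t5) + \<beta> (Some t1) * \<alpha> (Some t1) ^ 3
       + 3 * \<beta> (Some t2) * \<alpha> (Some t1) ^ 2 + 3 * \<beta> (Some t3) * \<alpha> (Some t1) + \<beta> (Some t5)"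
    "butcher_prod \<alpha> \<beta> (Some t6) = \<alpha> (Some t6) + \<beta> (Some t1) * \<alpha> (Some t1) * \<alpha> (Some t2)
       + \<beta> (Some t2) * \<alpha> (Some t2) + \<beta> (Some t2) * \<alpha> (Some t1) ^ 2
       + \<beta> (Some t3) * \<alpha> (Some t1) + \<beta> (Some t4) * \<alpha> (Some t1) + \<beta> (Some t6)"
    "butcher_prod \<alpha> \<beta> (Some t7) = \<alpha> (Some t7) + \<beta> (Some t1) * \<alpha> (Some t3)
       + \<beta> (Some t2) * \<alpha> (Some t1) ^ 2 + 2 * \<beta> (Some t4) * \<alpha> (Some t1) + \<beta> (Some t7)"
    "butcher_prod \<alpha> \<beta> (Some t8) = \<alpha> (Some t8) + \<beta> (Some t1) * \<alpha> (Some t4)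
       + \<beta> (Some t2) * \<alpha> (Some t2) + \<beta> (Some t4) * \<alpha> (Some t1) + \<beta> (Some t8)"
  using assms
  by (simp_all add: branch_sum_def add_mset_commute power2_eq_square power3_eq_cube algebra_simps)

section \<open>Elementary weights of explicit four-stage methods\<close>

lemma sum_lessThan_4: "(\<Sum>j<4. f j) = f 0 + f 1 + f 2 + f (3::nat)"
  by (simp add: eval_nat_numeral)

lemma rk_explicit_4_zeros:
  assumes "rk_method 4 A b" "rk_explicit A"
  shows "A $$ (0, 0) = 0" "A $$ (0, 1) = 0" "A $$ (0, 2) = 0" "A $$ (0, 3) = 0"
    "A $$ (1, 1) = 0" "A $$ (1, 2) = 0" "A $$ (1, 3) = 0" "A $$ (2, 2) = 0" "A $$ (2, 3) = 0"
    "A $$ (3, 3) = 0"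
  using assms by (auto simp: rk_explicit_def rk_method_def)

text \<open>The coefficients are named by equations so that the formulas can be instantiated with
  matrix entries (through \<open>refl\<close>) as well as with parameter expressions.\<close>

lemma explicit_weights:
  fixes A :: "real mat" and b :: "real vec"
  assumes rk: "rk_method 4 A b" and ex: "rk_explicit A"
    and a: "a21 = A $$ (1, 0)" "a31 = A $$ (2, 0)" "a32 = A $$ (2, 1)"
      "a41 = A $$ (3, 0)" "a42 = A $$ (3, 1)" "a43 = A $$ (3, 2)"
    and b: "b1 = b $ 0" "b2 = b $ 1" "b3 = b $ 2" "b4 = b $ 3"
    and c: "c2 = a21" "c3 = a31 + a32" "c4 = a41 + a42 + a43"
  shows "elementary_weight A b (Some t1) = b1 + b2 + b3 + b4"
    "elementary_weight A b (Some t2) = b2 * c2 + b3 * c3 + b4 * c4"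
    "elementary_weight A b (Some t3) = b2 * c2 ^ 2 + b3 * c3 ^ 2 + b4 * c4 ^ 2"
    "elementary_weight A b (Some t4) = b3 * a32 * c2 + b4 * (a42 * c2 + a43 * c3)"
    "elementary_weight A b (Some t5) = b2 * c2 ^ 3 + b3 * c3 ^ 3 + b4 * c4 ^ 3"
    "elementary_weight A b (Some t6) = b3 * c3 * a32 * c2 + b4 * c4 * (a42 * c2 + a43 * c3)"
    "elementary_weight A b (Some t7) = b3 * a32 * c2 ^ 2 + b4 * (a42 * c2 ^ 2 + a43 * c3 ^ 2)"
    "elementary_weight A b (Some t8) = b4 * a43 * a32 * c2"
proof -
  have dims: "dim_row A = 4" "dim_col A = 4" "dim_vec b = 4"
    using rk by (auto simp: rk_method_def)
  note zs = rk_explicit_4_zeros[OF rk ex]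
  note zs' = zs[unfolded One_nat_def]
  note simps = dims sum_lessThan_4 zs zs' a b c power2_eq_square power3_eq_cube algebra_simps
  show "elementary_weight A b (Some t1) = b1 + b2 + b3 + b4"
    "elementary_weight A b (Some t2) = b2 * c2 + b3 * c3 + b4 * c4"
    "elementary_weight A b (Some t3) = b2 * c2 ^ 2 + b3 * c3 ^ 2 + b4 * c4 ^ 2"
    "elementary_weight A b (Some t4) = b3 * a32 * c2 + b4 * (a42 * c2 + a43 * c3)"
    "elementary_weight A b (Some t5) = b2 * c2 ^ 3 + b3 * c3 ^ 3 + b4 * c4 ^ 3"
    "elementary_weight A b (Some t6) = b3 * c3 * a32 * c2 + b4 * c4 * (a42 * c2 + a43 * c3)"
    "elementary_weight A b (Some t7) = b3 * a32 * c2 ^ 2 + b4 * (a42 * c2 ^ 2 + a43 * c3 ^ 2)"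
    "elementary_weight A b (Some t8) = b4 * a43 * a32 * c2"
    by (simp_all add: simps)
qed

lemma exact_evolution_trees:
  "exact_evolution (Some t1) = 1" "exact_evolution (Some t2) = 1 / 2"
  "exact_evolution (Some t3) = 1 / 3" "exact_evolution (Some t4) = 1 / 6"
  "exact_evolution (Some t5) = 1 / 4" "exact_evolution (Some t6) = 1 / 8"
  "exact_evolution (Some t7) = 1 / 12" "exact_evolution (Some t8) = 1 / 24"
  by simp_all

section \<open>Effective order four\<close>

text \<open>Here c = (0, 1, -1, 0) and A c = (0, 0, 0, 1). The vectors 1, c, c^2, A c are linearly
  independent, so weights can be chosen with prescribed values 0, x, y, z on \<open>t1\<close> to
  \<open>t4\<close>.\<close>

definition conjugator_mat :: "real mat" where
  "conjugator_mat = mat 4 4 (\<lambda>(i, j).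
     [[0, 0, 0, 0], [1, 0, 0, 0], [-1, 0, 0, 0], [-1, 1, 0, 0]] ! i ! j)"

definition conjugator_vec :: "real \<Rightarrow> real \<Rightarrow> real \<Rightarrow> real vec" where
  "conjugator_vec x y z = vec 4 (\<lambda>i. [- y - z, (x + y) / 2, (y - x) / 2, z] ! i)"

text \<open>The coefficients \<open>a\<^sub>i\<^sub>j - b\<^sub>j\<close>, \<open>- b\<^sub>j\<close> undo a step of the method \<open>(A, b)\<close>.\<close>

definition inverse_mat :: "real mat \<Rightarrow> real vec \<Rightarrow> real mat" where
  "inverse_mat A b = mat (dim_row A) (dim_col A) (\<lambda>(i, j). A $$ (i, j) - b $ j)"

lemma elementary_weight_conjugator:
  fixes x y z :: real
  defines "\<beta> \<equiv> elementary_weight conjugator_mat (conjugator_vec x y z)"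
  shows "rk_method 4 conjugator_mat (conjugator_vec x y z)"
    "\<beta> (Some t1) = 0" "\<beta> (Some t2) = x" "\<beta> (Some t3) = y" "\<beta> (Some t4) = z"
    "\<beta> (Some t5) = x" "\<beta> (Some t6) = 0" "\<beta> (Some t7) = z" "\<beta> (Some t8) = 0"
proof -
  show rk: "rk_method 4 conjugator_mat (conjugator_vec x y z)"
    by (simp add: rk_method_def conjugator_mat_def conjugator_vec_def)
  have ex: "rk_explicit conjugator_mat"
    unfolding rk_explicit_def conjugator_mat_def by (auto simp: less_Suc_eq eval_nat_numeral)
  show "\<beta> (Some t1) = 0" "\<beta> (Some t2) = x" "\<beta> (Some t3) = y" "\<beta> (Some t4) = z"
    "\<beta> (Some t5) = x" "\<beta> (Some t6) = 0" "\<beta> (Some t7) = z" "\<beta> (Some t8) = 0"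
    unfolding \<beta>_def
      explicit_weights[OF rk ex refl refl refl refl refl refl refl refl refl refl refl refl refl]
    by (simp_all add: conjugator_mat_def conjugator_vec_def field_simps)
qed

text \<open>The values agree with the group inverse: since \<beta> and \<beta>' vanish at
  \<open>t1\<close>, only the cuts of \<open>t6\<close> and \<open>t8\<close> into two copies of
  \<open>t2\<close> give a correction, namely x^2.\<close>

lemma elementary_weight_conjugator_inverse:
  fixes x y z :: real
  defines "b \<equiv> conjugator_vec x y z"
  defines "B \<equiv> inverse_mat conjugator_mat b"
  defines "\<beta>' \<equiv> elementary_weight B (- b)"
  shows "rk_method 4 B (- b)"
    "\<beta>' (Some t1) = 0" "\<beta>' (Some t2) = - x" "\<beta>' (Some t3) = - y" "\<beta>' (Some t4) = - z"
    "\<beta>' (Some t5) = - x" "\<beta>' (Some t6) = x ^ 2" "\<beta>' (Some t7) = - z" "\<beta>' (Some t8) = x ^ 2"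
proof -
  \<comment> \<open>\<open>W\<close> is the weighted sum of the conjugating method. Each row of
    \<open>B\<close> is a row of \<open>conjugator_mat\<close> minus the weights, so
    \<open>W\<close> of the stage weights both gives the elementary weight and leads to the next
    tree.\<close>
  define W where "W f = (- y - z) * f 0 + (x + y) / 2 * f 1 + (y - x) / 2 * f 2 + z * f 3"
    for f :: "nat \<Rightarrow> real"
  have dims: "dim_row B = 4" "dim_col B = 4" "dim_vec b = 4"
    by (simp_all add: B_def inverse_mat_def conjugator_mat_def b_def conjugator_vec_def)
  show "rk_method 4 B (- b)"
    unfolding rk_method_def
    using carrier_matI[OF dims(1,2)] carrier_vecI[OF dims(3)] uminus_carrier_vec by blast
  have row: "(\<Sum>j<4. B $$ (0, j) * f j) = - W f"
    "(\<Sum>j<4. B $$ (1, j) * f j) = f 0 - W f"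
    "(\<Sum>j<4. B $$ (2, j) * f j) = - f 0 - W f"
    "(\<Sum>j<4. B $$ (3, j) * f j) = f 1 - f 0 - W f" for f
    by (simp_all add: sum_lessThan_4 B_def inverse_mat_def conjugator_mat_def b_def
        conjugator_vec_def W_def algebra_simps)
  have ew: "\<beta>' (Some t) = - W (stage_weight B t)" for t
    by (simp add: \<beta>'_def dims sum_lessThan_4 b_def conjugator_vec_def W_def algebra_simps)
  have 1: "stage_weight B t1 i = 1" for i by simp
  have W1: "W (\<lambda>_. 1) = 0" "W (stage_weight B t1) = 0" by (simp_all add: W_def field_simps)
  note step = stage_weight.simps dims row row[of "\<lambda>_. 1", unfolded mult_1_right W1]
  have 2: "stage_weight B t2 0 = 0" "stage_weight B t2 1 = 1" "stage_weight B t2 2 = -1"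
    "stage_weight B t2 3 = 0"
    by (simp_all add: step W1 1 del: One_nat_def)
  have W2: "W (stage_weight B t2) = x" unfolding W_def 2 by (simp add: field_simps)
  have 3: "stage_weight B t3 0 = 0" "stage_weight B t3 1 = 1" "stage_weight B t3 2 = 1"
    "stage_weight B t3 3 = 0"
    by (simp_all add: step W1 1 del: One_nat_def)
  have W3: "W (stage_weight B t3) = y" unfolding W_def 3 by (simp add: field_simps)
  have 4: "stage_weight B t4 0 = - x" "stage_weight B t4 1 = - x" "stage_weight B t4 2 = - x"
    "stage_weight B t4 3 = 1 - x"
    unfolding stage_weight.simps[of _ "{#t2#}"]
    by (simp_all add: dims row W2 2 del: One_nat_def stage_weight.simps)
  have W4: "W (stage_weight B t4) = z" unfolding W_def 4 by (simp add: field_simps)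
  have 5: "stage_weight B t5 0 = 0" "stage_weight B t5 1 = 1" "stage_weight B t5 2 = -1"
    "stage_weight B t5 3 = 0"
    by (simp_all add: step W1 1 del: One_nat_def)
  have W5: "W (stage_weight B t5) = x" unfolding W_def 5 by (simp add: field_simps)
  have 6: "stage_weight B t6 0 = 0" "stage_weight B t6 1 = - x" "stage_weight B t6 2 = x"
    "stage_weight B t6 3 = 0"
    unfolding stage_weight.simps[of _ "{#t1, t2#}"]
    by (simp_all add: dims row W1 W2 1 2 del: One_nat_def stage_weight.simps)
  have W6: "W (stage_weight B t6) = - (x ^ 2)"
    unfolding W_def 6 by (simp add: field_simps power2_eq_square)
  have 7: "stage_weight B t7 0 = - y" "stage_weight B t7 1 = - y" "stage_weight B t7 2 = - y"
    "stage_weight B t7 3 = 1 - y"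
    unfolding stage_weight.simps[of _ "{#t3#}"]
    by (simp_all add: dims row W3 3 del: One_nat_def stage_weight.simps)
  have W7: "W (stage_weight B t7) = z" unfolding W_def 7 by (simp add: field_simps)
  have 8: "stage_weight B t8 0 = - z" "stage_weight B t8 1 = - x - z" "stage_weight B t8 2 = x - z"
    "stage_weight B t8 3 = - z"
    unfolding stage_weight.simps[of _ "{#t4#}"]
    by (simp_all add: dims row W4 4 del: One_nat_def stage_weight.simps)
  have W8: "W (stage_weight B t8) = - (x ^ 2)"
    unfolding W_def 8 by (simp add: field_simps power2_eq_square)
  show "\<beta>' (Some t1) = 0" "\<beta>' (Some t2) = - x" "\<beta>' (Some t3) = - y" "\<beta>' (Some t4) = - z"
    "\<beta>' (Some t5) = - x" "\<beta>' (Some t6) = x ^ 2" "\<beta>' (Some t7) = - z" "\<beta>' (Some t8) = x ^ 2"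
    unfolding ew W1(2) W2 W3 W4 W5 W6 W7 W8 by simp_all
qed

text \<open>If \<beta> vanishes at \<open>t1\<close>, the conditions at \<open>t1\<close>,
  \<open>t2\<close>, \<open>t4\<close>, \<open>t8\<close> constrain \<alpha> alone, while those at
  \<open>t3\<close>, \<open>t5\<close>, \<open>t6\<close>, \<open>t7\<close> are affine in the three
  values x, y, z of \<beta>. Eliminating these leaves \<open>combination\<close>.\<close>

lemma effective_order_4I:
  assumes w: "elementary_weight A b (Some t1) = 1" "elementary_weight A b (Some t2) = 1 / 2"
    "elementary_weight A b (Some t4) = 1 / 6" "elementary_weight A b (Some t8) = 1 / 24"
    and combination: "1 / 4 - elementary_weight A b (Some t3) + elementary_weight A b (Some t5)
      - 2 * elementary_weight A b (Some t6) + elementary_weight A b (Some t7) = 0"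
  shows "effective_order 4 A b"
proof -
  define \<alpha> where "\<alpha> = elementary_weight A b"
  \<comment> \<open>Solve the conditions at \<open>t3\<close>, \<open>t5\<close> and
    \<open>t6\<close> in turn; the condition at \<open>t7\<close> is then
    \<open>combination\<close>.\<close>
  define x where "x = (\<alpha> (Some t3) - 1 / 3) / 2"
  define y where "y = (\<alpha> (Some t5) - 1 / 4) / 3 - x"
  define z where "z = \<alpha> (Some t6) - 1 / 8 - x - y"
  define b' where "b' = conjugator_vec x y z"
  define \<beta> where "\<beta> = elementary_weight conjugator_mat b'"
  define \<beta>' where "\<beta>' = elementary_weight (inverse_mat conjugator_mat b') (- b')"
  note S = elementary_weight_conjugator[of x y z, folded b'_def, folded \<beta>_def]
  note S' = elementary_weight_conjugator_inverse[of x y z, folded b'_def, folded \<beta>'_def]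
  have none: "\<beta> None = 1" "\<beta>' None = 1" "\<alpha> None = 1"
    by (simp_all add: \<beta>_def \<beta>'_def \<alpha>_def)
  have \<alpha>: "\<alpha> (Some t1) = 1" "\<alpha> (Some t2) = 1 / 2" "\<alpha> (Some t3) = 1 / 3 + 2 * x"
    "\<alpha> (Some t4) = 1 / 6" "\<alpha> (Some t5) = 1 / 4 + 3 * x + 3 * y"
    "\<alpha> (Some t6) = 1 / 8 + x + y + z" "\<alpha> (Some t7) = 1 / 12 + x + 2 * z - y"
    "\<alpha> (Some t8) = 1 / 24"
    using w combination unfolding \<alpha>_def[symmetric] by (simp_all add: x_def y_def z_def field_simps)
  have "\<forall>t. num_vertices t \<le> 4 \<longrightarrow> butcher_prod \<beta>' \<beta> t = butcher_one t \<and>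
             butcher_prod (butcher_prod \<beta> \<alpha>) \<beta>' t = exact_evolution t"
    unfolding all_tree_size_le_4 butcher_prod_trees[where \<beta> = \<beta>, OF none(1)]
      butcher_prod_trees[where \<beta> = \<beta>', OF none(2)]
      butcher_prod_trees[where \<beta> = \<alpha>, OF none(3)] S S' \<alpha> exact_evolution_trees
    by (simp add: none, simp add: power2_eq_square power3_eq_cube field_simps)
  then show ?thesis
    unfolding effective_order_def Let_def \<alpha>_def \<beta>_def \<beta>'_def using S(1) S'(1) by blast
qed

section \<open>No explicit four-stage method of order four\<close>

lemma no_nonneg_order_4_coefficients:
  fixes r :: real
  assumes c: "c2 = a21" "c3 = a31 + a32" "c4 = a41 + a42 + a43"
    and order: "b1 + b2 + b3 + b4 = 1"
      "b2 * c2 + b3 * c3 + b4 * c4 = 1 / 2"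
      "b2 * c2 ^ 2 + b3 * c3 ^ 2 + b4 * c4 ^ 2 = 1 / 3"
      "b3 * a32 * c2 + b4 * (a42 * c2 + a43 * c3) = 1 / 6"
      "b2 * c2 ^ 3 + b3 * c3 ^ 3 + b4 * c4 ^ 3 = 1 / 4"
      "b3 * c3 * a32 * c2 + b4 * c4 * (a42 * c2 + a43 * c3) = 1 / 8"
      "b3 * a32 * c2 ^ 2 + b4 * (a42 * c2 ^ 2 + a43 * c3 ^ 2) = 1 / 12"
      "b4 * a43 * a32 * c2 = 1 / 24"
    and nonneg: "0 \<le> a21" "0 \<le> a32" "0 \<le> a43" "0 \<le> a41" "0 \<le> b2" "0 \<le> b3" "0 \<le> b4"
    and ssp: "0 < r" "r * a32 * a21 \<le> a31" "r * a43 * a32 \<le> a42"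
  shows False
proof -
  \<comment> \<open>The condition at \<open>t8\<close> is a single product, so all its nonnegative
    factors are positive. This turns the inequalities in r into a31 > 0 and a42 > 0.\<close>
  have "b4 \<noteq> 0" "a43 \<noteq> 0" "a32 \<noteq> 0" "c2 \<noteq> 0"
    using order(8) by auto
  then have pos: "0 < b4" "0 < a43" "0 < a32" "0 < c2"
    using nonneg c by auto
  then have "0 < r * a32 * a21" "0 < r * a43 * a32"
    using ssp(1) c(1) by auto
  then have pos': "0 < a31" "0 < a42" using ssp by linarith+

  \<comment> \<open>\<open>x\<close> and \<open>y\<close> are the third and fourth entries of A c.
    The \<open>d\<close>s are the defects of the simplifying assumption; the order conditions make
    them orthogonal to c, c^2 and A c, for c by 1/6 - 1/2 + 1/3 = 0.\<close>
  define x y where "x = a32 * c2" and "y = a42 * c2 + a43 * c3"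
  define d2 d3 d4 where "d2 = b3 * a32 + b4 * a42 - b2 * (1 - c2)"
    and "d3 = b4 * a43 - b3 * (1 - c3)" and "d4 = - b4 * (1 - c4)"
  define D where "D = c2 * (c3 ^ 2 * y - x * c4 ^ 2) - c2 ^ 2 * (c3 * y - x * c4)"
  have d: "d2 * c2 + d3 * c3 + d4 * c4 = 0" "d2 * c2 ^ 2 + d3 * c3 ^ 2 + d4 * c4 ^ 2 = 0"
    "d3 * x + d4 * y = 0"
    using order unfolding d2_def d3_def d4_def x_def y_def
    by (simp_all add: algebra_simps power2_eq_square power3_eq_cube)
  \<comment> \<open>\<open>D\<close> is the determinant of the rows \<open>(c\<^sub>i, c\<^sub>i\<^sup>2, (A c)\<^sub>i)\<close>, \<open>i = 2, 3, 4\<close>. It is nonzero because its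
    product with the matrix with rows \<open>(b\<^sub>i)\<close>, \<open>(b\<^sub>i c\<^sub>i)\<close>, \<open>(1, 0, 0)\<close> has a determinant that is known
    from the order conditions.\<close>
  have det: "(b3 * (b4 * c4) - b4 * (b3 * c3)) * D =
    (b2 * c2 + b3 * c3 + b4 * c4) * (0 - (b3 * c3 * x + b4 * c4 * y) * c2 ^ 2)
    - (b2 * c2 ^ 2 + b3 * c3 ^ 2 + b4 * c4 ^ 2) * (0 - (b3 * c3 * x + b4 * c4 * y) * c2)
    + (b3 * x + b4 * y) * ((b2 * c2 ^ 2 + b3 * c3 ^ 2 + b4 * c4 ^ 2) * c2 ^ 2
        - (b2 * c2 ^ 3 + b3 * c3 ^ 3 + b4 * c4 ^ 3) * c2)"
    unfolding D_def by (simp add: algebra_simps power2_eq_square power3_eq_cube)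
  have v: "b3 * c3 * x + b4 * c4 * y = 1 / 8" "b3 * x + b4 * y = 1 / 6"
    using order unfolding x_def y_def by (simp_all add: algebra_simps)
  have "(b3 * (b4 * c4) - b4 * (b3 * c3)) * D = - (c2 ^ 2) / 144"
    unfolding det unfolding order(2,3,5) v by (simp add: field_simps)
  then have "D \<noteq> 0" using pos by auto
  \<comment> \<open>Cramer's rule: each product is a combination of the three left-hand sides in
    \<open>d\<close>.\<close>
  moreover have
    "d2 * D = (d2 * c2 + d3 * c3 + d4 * c4) * (c3 ^ 2 * y - c4 ^ 2 * x)
       - (d2 * c2 ^ 2 + d3 * c3 ^ 2 + d4 * c4 ^ 2) * (c3 * y - c4 * x)
       + (d3 * x + d4 * y) * (c3 * c4 ^ 2 - c3 ^ 2 * c4)"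
    "d3 * D = - (d2 * c2 + d3 * c3 + d4 * c4) * (c2 ^ 2 * y)
       + (d2 * c2 ^ 2 + d3 * c3 ^ 2 + d4 * c4 ^ 2) * (c2 * y)
       - (d3 * x + d4 * y) * (c2 * c4 ^ 2 - c2 ^ 2 * c4)"
    "d4 * D = (d2 * c2 + d3 * c3 + d4 * c4) * (c2 ^ 2 * x)
       - (d2 * c2 ^ 2 + d3 * c3 ^ 2 + d4 * c4 ^ 2) * (c2 * x)
       + (d3 * x + d4 * y) * (c2 * c3 ^ 2 - c2 ^ 2 * c3)"
    unfolding D_def by (simp_all add: algebra_simps power2_eq_square)
  then have "d2 * D = 0" "d3 * D = 0" "d4 * D = 0"
    unfolding d by simp_all
  ultimately have "d2 = 0" "d3 = 0" "d4 = 0" by auto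
  then have D1: "b2 * (1 - c2) = b3 * a32 + b4 * a42" "b3 * (1 - c3) = b4 * a43" and c4: "c4 = 1"
    using pos unfolding d2_def d3_def d4_def by auto

  have "0 < b3 * (1 - c3)" using D1 pos by simp
  with nonneg(6) have b3: "0 < b3" "c3 < 1" by (auto simp: zero_less_mult_iff)
  have "0 < b3 * a32 + b4 * a42" using b3 pos pos' by (simp add: add_pos_pos)
  then have "0 < b2 * (1 - c2)" using D1 by simp
  with nonneg(5) have b2: "0 < b2" "c2 < 1" by (auto simp: zero_less_mult_iff)
  have c3: "0 < c3" using c pos pos' by simp
  note order' = order[unfolded c4]
  \<comment> \<open>The polynomial t (1 - t) (t - c3) vanishes at the abscissae 0, c3 and 1, so only
    the b2 term of the quadrature remains; its integral over [0, 1] is (1 - 2 c3) / 12. For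
    \<open>E3\<close>, exchange c2 and c3.\<close>
  have "b2 * c2 * (1 - c2) * (c2 - c3) =
      (b2 * c2 ^ 2 + b3 * c3 ^ 2 + b4 * 1 ^ 2) - (b2 * c2 ^ 3 + b3 * c3 ^ 3 + b4 * 1 ^ 3)
      - c3 * ((b2 * c2 + b3 * c3 + b4 * 1) - (b2 * c2 ^ 2 + b3 * c3 ^ 2 + b4 * 1 ^ 2))"
    by (simp add: algebra_simps power2_eq_square power3_eq_cube)
  then have E2: "b2 * c2 * (1 - c2) * (c2 - c3) = (1 - 2 * c3) / 12"
    unfolding order' by simp
  have "b3 * c3 * (1 - c3) * (c3 - c2) =
      (b2 * c2 ^ 2 + b3 * c3 ^ 2 + b4 * 1 ^ 2) - (b2 * c2 ^ 3 + b3 * c3 ^ 3 + b4 * 1 ^ 3)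
      - c2 * ((b2 * c2 + b3 * c3 + b4 * 1) - (b2 * c2 ^ 2 + b3 * c3 ^ 2 + b4 * 1 ^ 2))"
    by (simp add: algebra_simps power2_eq_square power3_eq_cube)
  then have E3: "b3 * c3 * (1 - c3) * (c3 - c2) = (1 - 2 * c2) / 12"
    unfolding order' by simp
  \<comment> \<open>\<open>D1\<close> turns the condition at \<open>t8\<close> into a formula for b3
    a32.\<close>
  have "b3 * a32 * (c2 * (1 - c3)) = b3 * (1 - c3) * a32 * c2" by simp
  then have E4: "b3 * a32 * (c2 * (1 - c3)) = 1 / 24"
    unfolding D1 order by simp
  \<comment> \<open>The right-hand side is b4 a42.\<close>
  have a42: "0 < b2 * (1 - c2) - b3 * a32"
    using D1(1) pos pos' by simp
  consider "c2 < c3" | "c2 = c3" | "c3 < c2" by linarith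
  then show False
  proof cases
    case 1
    have "0 < b2 * c2 * (1 - c2) * (c3 - c2)" using b2 pos 1 by simp
    with E2 have "1 / 2 < c3" by (simp add: algebra_simps)
    have "0 < b3 * c3 * (1 - c3) * (c3 - c2)" using b3 c3 1 by simp
    with E3 have c2: "c2 < 1 / 2" by simp
    \<comment> \<open>\<open>E3\<close> and \<open>E4\<close> express a32 through c2 and c3, so a31
      > 0, that is a32 < c3, bounds c3 - c2 from above.\<close>
    have "c3 * (c3 - c2) = 24 * (b3 * a32 * (c2 * (1 - c3))) * (c3 * (c3 - c2))"
      unfolding E4 by simp
    also have "\<dots> = a32 * (2 * c2 * (12 * (b3 * c3 * (1 - c3) * (c3 - c2))))"
      by (simp add: algebra_simps power2_eq_square)
    also have "\<dots> = a32 * (2 * c2 * (1 - 2 * c2))"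
      unfolding E3 by simp
    also have "\<dots> < c3 * (2 * c2 * (1 - 2 * c2))"
      using c pos pos' c2 by (intro mult_strict_right_mono) auto
    finally have *: "c3 - c2 < 2 * c2 * (1 - 2 * c2)"
      using c3 by simp
    \<comment> \<open>Likewise a42 > 0 gives a second upper bound on c3 - c2.\<close>
    have "0 < (b2 * (1 - c2) - b3 * a32) * (24 * c2 * (c3 - c2) * (1 - c3))"
      using a42 pos b3 1 by simp
    also have "\<dots> = - 24 * (b2 * c2 * (1 - c2) * (c2 - c3)) * (1 - c3)
        - 24 * (b3 * a32 * (c2 * (1 - c3))) * (c3 - c2)"
      by (simp add: algebra_simps power2_eq_square)
    also have "\<dots> = 2 * (2 * c3 - 1) * (1 - c3) - (c3 - c2)"
      unfolding E2 E4 by (simp add: field_simps)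
    finally have **: "c3 - c2 < 2 * (2 * c3 - 1) * (1 - c3)" by simp
    \<comment> \<open>The two upper bounds add up to at most 2 (c3 - c2), which is absurd.\<close>
    have sum: "2 * (2 * c3 - 1) * (1 - c3) + 2 * c2 * (1 - 2 * c2) =
      2 * (c3 - c2) - (1 - 2 * c2) ^ 2 - (1 - 2 * c3) ^ 2"
      by (simp add: algebra_simps power2_eq_square)
    have "False" if "d < u" "d < v" "u + v = 2 * d - s - t" "0 \<le> s" "0 \<le> t" for d u v s t :: real
      using that by linarith
    from this[OF ** * sum] show False by simp
  next
    \<comment> \<open>With both abscissae 1/2, a42 > 0 and a31 > 0 amount to b2 > 1/3 and b3 > 1/3,
      but b2 + b3 = 2/3.\<close>
    case 2
    with E2 E3 have c2: "c2 = 1 / 2" "c3 = 1 / 2" by simp_all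
    with order' have "b2 + b3 = 2 / 3"
      by (simp add: power2_eq_square field_simps)
    moreover have "b3 * a32 = 1 / 6" using E4 unfolding c2 by (simp add: field_simps)
    moreover have "b3 * a32 < b3 * (1 / 2)"
      using b3 c pos' c2 by (intro mult_strict_left_mono) auto
    ultimately show False using a42 c2 by simp
  next
    case 3
    have "0 < b2 * c2 * (1 - c2) * (c2 - c3)" using b2 pos 3 by simp
    with E2 have c3': "c3 < 1 / 2" by simp
    have "0 < b3 * c3 * (1 - c3) * (c2 - c3)" using b3 c3 3 by simp
    with E3 have c2': "1 / 2 < c2" by (simp add: algebra_simps)
    have *: "0 < (2 * c2 - 1) * (1 - 2 * c3)" using c2' c3' by simp
    \<comment> \<open>By \<open>D1\<close>, P = b3 a32 + b4 (a42 + a43), hence b4 a41 = b4 - P + b3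
      a32. The bounds P > 1/3, b4 < 1/6 and b3 a32 < 1/6 make this negative.\<close>
    define P where "P = b2 * (1 - c2) + b3 * (1 - c3)"
    have "P * (12 * c2 * c3) * (c2 - c3) = 12 * c3 * (b2 * c2 * (1 - c2) * (c2 - c3))
        - 12 * c2 * (b3 * c3 * (1 - c3) * (c3 - c2))"
      unfolding P_def by (simp add: algebra_simps power2_eq_square)
    also have "\<dots> = (2 * (c2 + c3) - 1) * (c2 - c3)"
      unfolding E2 E3 by (simp add: field_simps)
    finally have "P * (12 * c2 * c3) = 2 * (c2 + c3) - 1" using 3 by simp
    also have "\<dots> = 4 * (c2 * c3) + (2 * c2 - 1) * (1 - 2 * c3)" by (simp add: algebra_simps power2_eq_square)
    finally have "1 / 3 * (12 * (c2 * c3)) < P * (12 * (c2 * c3))" using * by simp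
    then have P: "1 / 3 < P" using pos c3 by (simp add: mult_less_cancel_right)
    \<comment> \<open>The polynomial t (t - c2) (t - c3) isolates the b4 term.\<close>
    have "b4 * (12 * ((1 - c2) * (1 - c3))) = 12 * ((b2 * c2 ^ 3 + b3 * c3 ^ 3 + b4 * 1 ^ 3)
        - (c2 + c3) * (b2 * c2 ^ 2 + b3 * c3 ^ 2 + b4 * 1 ^ 2)
        + c2 * c3 * (b2 * c2 + b3 * c3 + b4 * 1))"
      by (simp add: algebra_simps power2_eq_square power3_eq_cube)
    also have "\<dots> = 6 * c2 * c3 - 4 * (c2 + c3) + 3"
      unfolding order' by (simp add: field_simps)
    also have "\<dots> = 2 * ((1 - c2) * (1 - c3)) - (2 * c2 - 1) * (1 - 2 * c3)" by (simp add: algebra_simps power2_eq_square)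
    finally have "b4 * (12 * ((1 - c2) * (1 - c3))) < 1 / 6 * (12 * ((1 - c2) * (1 - c3)))"
      using * by simp
    moreover have "0 < 12 * ((1 - c2) * (1 - c3))" using b2 b3 by simp
    ultimately have B4: "b4 < 1 / 6" using mult_less_cancel_right_pos by blast
    have "1 / 2 * (1 / 2) < c2 * (1 - c3)"
      using c2' c3' by (intro mult_strict_mono) auto
    then have "b3 * a32 * (1 / 2 * (1 / 2)) < b3 * a32 * (c2 * (1 - c3))"
      using b3 pos by (intro mult_strict_left_mono) auto
    then have "b3 * a32 < 1 / 6" unfolding E4 by (simp add: field_simps)
    moreover have "b4 * a41 = b4 - P + b3 * a32"
    proof -
      have a41: "a41 = 1 - a42 - a43" using c4 c(3) by simp
      have "b4 * a41 = b4 - b4 * a42 - b4 * a43" unfolding a41 by (simp add: algebra_simps)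
      then show ?thesis using D1 unfolding P_def by linarith
    qed
    ultimately show False
      using P B4 mult_nonneg_nonneg[OF nonneg(7,4)] by linarith
  qed
qed

section \<open>Conditions for a positive SSP coefficient\<close>

text \<open>\<open>Q\<close> stands for K (I + r A)^(-1). For an explicit method I + r A is unit
  lower triangular, hence invertible, and the inverse can be traded for a linear system.\<close>

lemma ssp_conditions_iff:
  assumes "rk_method s A b" "rk_explicit A"
  shows "ssp_conditions A b r \<longleftrightarrow>
    (\<exists>Q \<in> carrier_mat (s + 1) s. Q * (1\<^sub>m s + r \<cdot>\<^sub>m A) = K_mat A b \<and> 0\<^sub>m (s + 1) s \<le> Q \<and>
       (\<forall>i<s + 1. r * (\<Sum>j<s. Q $$ (i, j)) \<le> 1))" (is "_ \<longleftrightarrow> ?R")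
proof -
  define M where "M = 1\<^sub>m s + r \<cdot>\<^sub>m A"
  have A: "A \<in> carrier_mat s s" and b: "dim_vec b = s"
    using assms by (auto simp: rk_method_def)
  have M: "M \<in> carrier_mat s s" using A by (simp add: M_def)
  have K: "K_mat A b \<in> carrier_mat (s + 1) s" by (simp add: K_mat_def b)
  have rowsums: "0\<^sub>v (s + 1) \<le> ones (s + 1) - r \<cdot>\<^sub>v (Q *\<^sub>v ones s) \<longleftrightarrow>
      (\<forall>i<s + 1. r * (\<Sum>j<s. Q $$ (i, j)) \<le> 1)" if "Q \<in> carrier_mat (s + 1) s" for Q
    using that
    by (auto simp: less_eq_vec_def ones_def scalar_prod_def row_def atLeast0LessThan)
  have ex: "\<exists>N \<in> carrier_mat s s. inverts_mat M N \<and> inverts_mat N M"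
  proof -
    have "det M = prod_list (diag_mat M)"
    proof (rule det_lower_triangular[OF _ M])
      fix i j assume "i < j" "j < s"
      then show "M $$ (i, j) = 0"
        using assms(2) A by (auto simp: M_def rk_explicit_def)
    qed
    also have "diag_mat M = map (\<lambda>_. 1) [0..<s]"
      using assms(2) A by (auto simp: M_def rk_explicit_def diag_mat_def)
    finally have "det M \<noteq> 0" by auto
    from det_non_zero_imp_unit[OF M this]
    show ?thesis by (auto simp: Units_def ring_mat_def inverts_mat_def M[THEN carrier_matD(1)])
  qed
  show ?thesis
  proof
    assume "ssp_conditions A b r"
    then obtain N where N: "N \<in> carrier_mat s s" "inverts_mat N M"
      "0\<^sub>m (s + 1) s \<le> K_mat A b * N"
      "0\<^sub>v (s + 1) \<le> ones (s + 1) - r \<cdot>\<^sub>v ((K_mat A b * N) *\<^sub>v ones s)"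
      unfolding ssp_conditions_def Let_def b M_def by blast
    have "K_mat A b * N * M = K_mat A b"
      using N(1,2) M K by (simp add: assoc_mult_mat[of _ "s + 1" s _ s _ s] inverts_mat_def)
    moreover have "K_mat A b * N \<in> carrier_mat (s + 1) s" using K N by simp
    ultimately show ?R using N(3,4) rowsums unfolding M_def by blast
  next
    assume ?R
    then obtain Q where Q: "Q \<in> carrier_mat (s + 1) s" "Q * M = K_mat A b" "0\<^sub>m (s + 1) s \<le> Q"
       "\<forall>i<s + 1. r * (\<Sum>j<s. Q $$ (i, j)) \<le> 1"
      unfolding M_def by blast
    obtain N where N: "N \<in> carrier_mat s s" "inverts_mat M N" "inverts_mat N M"
      using ex by blast
    have "K_mat A b * N = Q"
      unfolding Q(2)[symmetric]
      using N(1,2) M Q(1) by (simp add: assoc_mult_mat[of _ "s + 1" s _ s _ s] inverts_mat_def)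
    then show "ssp_conditions A b r"
      unfolding ssp_conditions_def Let_def b M_def[symmetric]
      using N Q rowsums by (intro bexI[of _ N]) auto
  qed
qed

lemma ssp_coefficient_pos_iff: "0 < ssp_coefficient A b \<longleftrightarrow> (\<exists>r>0. ssp_conditions A b r)"
proof
  assume "0 < ssp_coefficient A b"
  then show "\<exists>r>0. ssp_conditions A b r"
    unfolding ssp_coefficient_def less_Sup_iff by auto
next
  assume "\<exists>r>0. ssp_conditions A b r"
  then obtain r where "0 < ereal r" "ereal r \<in> ereal ` {r. 0 \<le> r \<and> ssp_conditions A b r}"
    by auto
  then show "0 < ssp_coefficient A b"
    unfolding ssp_coefficient_def less_Sup_iff by blast
qed

lemma mult_one_plus_smult_eq_iff:
  fixes A :: "'a :: comm_ring_1 mat"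
  assumes "Q \<in> carrier_mat m s" "A \<in> carrier_mat s s" "K \<in> carrier_mat m s"
  shows "Q * (1\<^sub>m s + r \<cdot>\<^sub>m A) = K \<longleftrightarrow>
    (\<forall>i<m. \<forall>j<s. K $$ (i, j) = Q $$ (i, j) + r * (\<Sum>k<s. Q $$ (i, k) * A $$ (k, j)))"
proof -
  have eq: "Q * (1\<^sub>m s + r \<cdot>\<^sub>m A) = Q + r \<cdot>\<^sub>m (Q * A)"
    using assms
    by (subst mult_add_distrib_mat[of _ m s _ s]) (simp_all add: mult_smult_distrib[of _ m s _ s])
  have "(Q + r \<cdot>\<^sub>m (Q * A)) $$ (i, j) = Q $$ (i, j) + r * (\<Sum>k<s. Q $$ (i, k) * A $$ (k, j))"
    if "i < m" "j < s" for i j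
    using assms that by (simp add: scalar_prod_def atLeast0LessThan)
  then show ?thesis
    unfolding eq using assms by (auto simp: mat_eq_iff)
qed

lemma K_mat_4:
  assumes "rk_method 4 A b"
  shows "K_mat A b \<in> carrier_mat (4 + 1) 4" "i < 4 \<Longrightarrow> j < 4 \<Longrightarrow> K_mat A b $$ (i, j) = A $$ (i, j)"
    "j < 4 \<Longrightarrow> K_mat A b $$ (4, j) = b $ j"
  using assms by (auto simp: K_mat_def rk_method_def dest!: carrier_vecD)

text \<open>Solving the triangular system from the last column backwards, each coefficient is an
  entry of \<open>Q\<close> plus r times nonnegative products. The last two claims say that
  \<open>Q $$ (2, 0)\<close> and \<open>Q $$ (3, 1)\<close> are nonnegative.\<close>

lemma ssp_conditions_imp_coefficients:
  assumes rk: "rk_method 4 A b" and ex: "rk_explicit A" and r: "0 < r" and ssp: "ssp_conditions A b r"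
  shows "0 \<le> A $$ (1, 0)" "0 \<le> A $$ (2, 1)" "0 \<le> A $$ (3, 2)" "0 \<le> A $$ (3, 0)"
    "0 \<le> b $ 1" "0 \<le> b $ 2" "0 \<le> b $ 3"
    "r * A $$ (2, 1) * A $$ (1, 0) \<le> A $$ (2, 0)" "r * A $$ (3, 2) * A $$ (2, 1) \<le> A $$ (3, 1)"
proof -
  have A: "A \<in> carrier_mat 4 4" using rk by (simp add: rk_method_def)
  obtain Q where Q: "Q \<in> carrier_mat (4 + 1) 4" "Q * (1\<^sub>m 4 + r \<cdot>\<^sub>m A) = K_mat A b"
    "0\<^sub>m (4 + 1) 4 \<le> Q"
    using ssp unfolding ssp_conditions_iff[OF rk ex] by blast
  have nonneg: "0 \<le> Q $$ (i, j)" if "i < 5" "j < 4" for i j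
    using Q(1,3) that by (auto simp: less_eq_mat_def)
  have "K_mat A b $$ (i, j) = Q $$ (i, j) + r * (\<Sum>k<4. Q $$ (i, k) * A $$ (k, j))"
    if "i < 5" "j < 4" for i j
    using Q(2) that unfolding mult_one_plus_smult_eq_iff[OF Q(1) A K_mat_4(1)[OF rk]] by simp
  then have K: "K_mat A b $$ (i, 3) = Q $$ (i, 3)"
    "K_mat A b $$ (i, 2) = Q $$ (i, 2) + r * (Q $$ (i, 3) * A $$ (3, 2))"
    "K_mat A b $$ (i, 1) = Q $$ (i, 1) + r * (Q $$ (i, 2) * A $$ (2, 1) + Q $$ (i, 3) * A $$ (3, 1))"
    "K_mat A b $$ (i, 0) = Q $$ (i, 0) + r * (Q $$ (i, 1) * A $$ (1, 0) + Q $$ (i, 2) * A $$ (2, 0)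
       + Q $$ (i, 3) * A $$ (3, 0))" if "i < 5" for i
    using that rk_explicit_4_zeros[OF rk ex] by (simp_all add: sum_lessThan_4)
  note zs = rk_explicit_4_zeros[OF rk ex]
  note KA = K_mat_4(2)[OF rk] and Kb = K_mat_4(3)[OF rk]
  have row1: "Q $$ (1, 3) = 0" using K(1)[of 1] zs by (simp add: KA del: One_nat_def)
  then have row1': "Q $$ (1, 2) = 0" using K(2)[of 1] zs by (simp add: KA del: One_nat_def)
  with row1 have row1'': "Q $$ (1, 1) = 0" using K(3)[of 1] zs by (simp add: KA del: One_nat_def)
  with row1 row1' have a21: "A $$ (1, 0) = Q $$ (1, 0)"
    using K(4)[of 1] by (simp add: KA del: One_nat_def)
  have row2: "Q $$ (2, 3) = 0" using K(1)[of 2] zs by (simp add: KA del: One_nat_def)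
  then have row2': "Q $$ (2, 2) = 0" using K(2)[of 2] zs by (simp add: KA del: One_nat_def)
  with row2 have a32: "A $$ (2, 1) = Q $$ (2, 1)"
    using K(3)[of 2] by (simp add: KA del: One_nat_def)
  with row2 row2' have a31: "A $$ (2, 0) = Q $$ (2, 0) + r * (A $$ (2, 1) * A $$ (1, 0))"
    using K(4)[of 2] by (simp add: KA del: One_nat_def)
  have row3: "Q $$ (3, 3) = 0" using K(1)[of 3] zs by (simp add: KA del: One_nat_def)
  then have a43: "A $$ (3, 2) = Q $$ (3, 2)"
    using K(2)[of 3] by (simp add: KA del: One_nat_def)
  with row3 have a42: "A $$ (3, 1) = Q $$ (3, 1) + r * (A $$ (3, 2) * A $$ (2, 1))"
    using K(3)[of 3] by (simp add: KA del: One_nat_def)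
  from a43 row3 have a41:
    "A $$ (3, 0) = Q $$ (3, 0) + r * (Q $$ (3, 1) * A $$ (1, 0) + A $$ (3, 2) * A $$ (2, 0))"
    using K(4)[of 3] by (simp add: KA del: One_nat_def)
  have row4: "b $ 3 = Q $$ (4, 3)" "b $ 2 = Q $$ (4, 2) + r * (b $ 3 * A $$ (3, 2))"
    "b $ 1 = Q $$ (4, 1) + r * (Q $$ (4, 2) * A $$ (2, 1) + b $ 3 * A $$ (3, 1))"
    using K[of 4] by (simp_all add: Kb del: One_nat_def)
  show a21': "0 \<le> A $$ (1, 0)" and a32': "0 \<le> A $$ (2, 1)" and a43': "0 \<le> A $$ (3, 2)"
    and b4: "0 \<le> b $ 3"
    unfolding a21 a32 a43 row4(1) by (simp_all add: nonneg)
  show a31': "r * A $$ (2, 1) * A $$ (1, 0) \<le> A $$ (2, 0)"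
    and a42': "r * A $$ (3, 2) * A $$ (2, 1) \<le> A $$ (3, 1)"
    using a31 a42 nonneg[of 2 0] nonneg[of 3 1] by (simp_all add: mult.assoc)
  have "0 \<le> r * A $$ (2, 1) * A $$ (1, 0)" "0 \<le> r * A $$ (3, 2) * A $$ (2, 1)"
    using r a21' a32' a43' by simp_all
  then have "0 \<le> A $$ (2, 0)" "0 \<le> A $$ (3, 1)" using a31' a42' by linarith+
  then show "0 \<le> A $$ (3, 0)" "0 \<le> b $ 1" "0 \<le> b $ 2"
    unfolding a41 row4(2,3) using r a21' a32' a43' b4 by (simp_all add: nonneg)
qed

lemma no_explicit_ssp_order_4:
  assumes rk: "rk_method 4 A b" and ex: "rk_explicit A" and ord: "classical_order 4 A b"
    and ssp: "0 < ssp_coefficient A b"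
  shows False
proof -
  obtain r where r: "0 < r" "ssp_conditions A b r"
    using ssp unfolding ssp_coefficient_pos_iff by blast
  note w = explicit_weights[OF rk ex refl refl refl refl refl refl refl refl refl refl refl refl refl]
  show False
    using ord unfolding classical_order_def all_tree_size_le_4 w exact_evolution_trees
    by (elim conjE, intro no_nonneg_order_4_coefficients[OF refl refl refl])
       (rule ssp_conditions_imp_coefficients[OF rk ex r] r | assumption)+
qed

lemma all_less_4: "(\<forall>i<4. P i) \<longleftrightarrow> P 0 \<and> P 1 \<and> P 2 \<and> P (3::nat)"
  by (auto simp: eval_nat_numeral less_Suc_eq)

text \<open>At r = 0 the solution \<open>Q\<close> is K. Its entries are polynomials in r, so the
  positive ones stay positive for small r > 0, and r times the row sums stays below 1.\<close>

lemma ssp_coefficient_pos_if_coefficients_pos: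
  assumes rk: "rk_method 4 A b" and ex: "rk_explicit A"
    and a: "a21 = A $$ (1, 0)" "a31 = A $$ (2, 0)" "a32 = A $$ (2, 1)"
      "a41 = A $$ (3, 0)" "a42 = A $$ (3, 1)" "a43 = A $$ (3, 2)"
    and b: "b1 = b $ 0" "b2 = b $ 1" "b3 = b $ 2" "b4 = b $ 3"
    and pos: "0 < a21" "0 < a31" "0 < a32" "0 < a41" "0 < a42" "0 < a43"
      "0 < b1" "0 < b2" "0 < b3" "0 < b4"
  shows "0 < ssp_coefficient A b"
proof -
  \<comment> \<open>Back substitution in \<open>Q\<close> (I + r A) = K; the remaining entries of
    \<open>Q\<close> are those of K.\<close>
  define q20 where "q20 r = a31 - r * (a32 * a21)" for r
  define q31 where "q31 r = a42 - r * (a43 * a32)" for r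
  define q30 where "q30 r = a41 - r * (q31 r * a21 + a43 * a31)" for r
  define q42 where "q42 r = b3 - r * (b4 * a43)" for r
  define q41 where "q41 r = b2 - r * (q42 r * a32 + b4 * a42)" for r
  define q40 where "q40 r = b1 - r * (q41 r * a21 + q42 r * a31 + b4 * a41)" for r
  note defs = q20_def q31_def q30_def q42_def q41_def q40_def
  have cont: "isCont q20 0" "isCont q31 0" "isCont q42 0"
    unfolding q20_def q31_def q42_def by (intro continuous_intros)+
  have cont': "isCont q30 0" "isCont q41 0"
    unfolding q30_def q41_def by (intro continuous_intros cont)+
  have cont'': "isCont q40 0"
    unfolding q40_def by (intro continuous_intros cont cont')
  have zero: "q20 0 = a31" "q31 0 = a42" "q42 0 = b3" "q30 0 = a41" "q41 0 = b2" "q40 0 = b1"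
    by (simp_all add: defs)
  have ev: "eventually (\<lambda>r. 0 < f r) (at_right 0)" if "isCont f 0" "0 < f 0" for f :: "real \<Rightarrow> real"
    using order_tendstoD(1)[OF isContD[OF that(1)] that(2)]
    by (rule filter_leD[OF at_le, rotated]) simp
  have ev1: "eventually (\<lambda>r. 0 < 1 - r * f r) (at_right 0)" if "isCont f 0" for f :: "real \<Rightarrow> real"
    by (rule ev) (use that in \<open>auto intro: continuous_intros\<close>)
  have "eventually (\<lambda>r. 0 < r \<and> 0 < q20 r \<and> 0 < q31 r \<and> 0 < q30 r \<and> 0 < q42 r \<and> 0 < q41 r \<and>
      0 < q40 r \<and> 0 < 1 - r * a21 \<and> 0 < 1 - r * (q20 r + a32) \<and>
      0 < 1 - r * (q30 r + q31 r + a43) \<and> 0 < 1 - r * (q40 r + q41 r + q42 r + b4)) (at_right 0)"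
    by (intro eventually_conj eventually_at_right_less ev[OF cont(1)] ev[OF cont(2)] ev[OF cont(3)]
        ev[OF cont'(1)] ev[OF cont'(2)] ev[OF cont''] ev1 continuous_intros cont cont' cont'')
       (simp_all add: zero pos)
  from eventually_happens'[OF _ this] obtain r where r: "0 < r" and
    q: "0 < q20 r" "0 < q31 r" "0 < q30 r" "0 < q42 r" "0 < q41 r" "0 < q40 r" and
    sums: "r * a21 \<le> 1" "r * (q20 r + a32) \<le> 1" "r * (q30 r + q31 r + a43) \<le> 1"
      "r * (q40 r + q41 r + q42 r + b4) \<le> 1"
    by auto
  define Q where "Q = mat (4 + 1) 4 (\<lambda>(i, j). [[0, 0, 0, 0], [a21, 0, 0, 0], [q20 r, a32, 0, 0],
    [q30 r, q31 r, a43, 0], [q40 r, q41 r, q42 r, b4]] ! i ! j)"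
  have Q: "Q \<in> carrier_mat (4 + 1) 4" by (simp add: Q_def)
  have A: "A \<in> carrier_mat 4 4" using rk by (simp add: rk_method_def)
  have all_5: "(\<forall>i<4 + 1. P i) \<longleftrightarrow> P 0 \<and> P 1 \<and> P 2 \<and> P 3 \<and> P (4::nat)" for P
    by (auto simp: eval_nat_numeral less_Suc_eq)
  have Qe: "Q $$ (i, j) = [[0, 0, 0, 0], [a21, 0, 0, 0], [q20 r, a32, 0, 0],
    [q30 r, q31 r, a43, 0], [q40 r, q41 r, q42 r, b4]] ! i ! j" if "i < 4 + 1" "j < 4" for i j
    using that by (simp add: Q_def)
  note zs = rk_explicit_4_zeros[OF rk ex]
  have "Q * (1\<^sub>m 4 + r \<cdot>\<^sub>m A) = K_mat A b"
    unfolding mult_one_plus_smult_eq_iff[OF Q A K_mat_4(1)[OF rk]] all_less_4 all_5 sum_lessThan_4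
    by (simp add: K_mat_4[OF rk] zs zs[unfolded One_nat_def] Qe a[symmetric] b[symmetric]
        a[symmetric, unfolded One_nat_def] b[symmetric, unfolded One_nat_def] defs)
  moreover have "0\<^sub>m (4 + 1) 4 \<le> Q"
  proof -
    have "\<forall>i<4 + 1. \<forall>j<4. 0 \<le> Q $$ (i, j)"
      unfolding all_less_4 all_5 using q pos by (simp add: Qe)
    then show ?thesis using Q by (simp add: less_eq_mat_def)
  qed
  moreover have "\<forall>i<4 + 1. r * (\<Sum>j<4. Q $$ (i, j)) \<le> 1"
    unfolding all_5 sum_lessThan_4 using sums by (simp add: Qe)
  ultimately show ?thesis
    unfolding ssp_coefficient_pos_iff ssp_conditions_iff[OF rk ex] using r Q by blast
qed

section \<open>Rational methods of effective order four\<close>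

text \<open>In terms of the coefficients of the method, \<open>x = a\<^sub>3\<^sub>2 c\<^sub>2\<close>, \<open>m = b\<^sub>4 a\<^sub>4\<^sub>3\<close>, \<open>n = b\<^sub>4 a\<^sub>4\<^sub>2\<close>.\<close>

definition family_mat :: "real \<Rightarrow> real \<Rightarrow> real \<Rightarrow> real \<Rightarrow> real \<Rightarrow> real \<Rightarrow> real \<Rightarrow> real mat" where
  "family_mat c2 c3 c4 x m n b4 = mat 4 4 (\<lambda>(i, j).
     [[0, 0, 0, 0], [c2, 0, 0, 0], [c3 - x / c2, x / c2, 0, 0],
      [c4 - (n + m) / b4, n / b4, m / b4, 0]] ! i ! j)"

definition family_vec :: "real \<Rightarrow> real \<Rightarrow> real \<Rightarrow> real vec" where
  "family_vec b2 b3 b4 = vec 4 (\<lambda>i. [1 - b2 - b3 - b4, b2, b3, b4] ! i)"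

lemma rk_method_family: "rk_method 4 (family_mat c2 c3 c4 x m n b4) (family_vec b2 b3 b4)"
  by (simp add: rk_method_def family_mat_def family_vec_def)

lemma rk_explicit_family: "rk_explicit (family_mat c2 c3 c4 x m n b4)"
  unfolding rk_explicit_def family_mat_def by (auto simp: less_Suc_eq eval_nat_numeral)

text \<open>Using the products x, m, n as parameters clears the denominators: for fixed abscissae, x
  and m, all these weights are affine in b2, b3, b4 and n.\<close>

lemma family_weights:
  fixes c2 c3 c4 x m n b2 b3 b4 :: real
  assumes "0 < c2" "0 < b4"
  defines "\<alpha> \<equiv> elementary_weight (family_mat c2 c3 c4 x m n b4) (family_vec b2 b3 b4)"
  shows "\<alpha> (Some t1) = 1"
    "\<alpha> (Some t2) = b2 * c2 + b3 * c3 + b4 * c4"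
    "\<alpha> (Some t3) = b2 * c2 ^ 2 + b3 * c3 ^ 2 + b4 * c4 ^ 2"
    "\<alpha> (Some t4) = b3 * x + n * c2 + m * c3"
    "\<alpha> (Some t5) = b2 * c2 ^ 3 + b3 * c3 ^ 3 + b4 * c4 ^ 3"
    "\<alpha> (Some t6) = b3 * c3 * x + c4 * (n * c2 + m * c3)"
    "\<alpha> (Some t7) = b3 * x * c2 + n * c2 ^ 2 + m * c3 ^ 2"
    "\<alpha> (Some t8) = m * x"
proof -
  have A: "family_mat c2 c3 c4 x m n b4 $$ (1, 0) = c2"
    "family_mat c2 c3 c4 x m n b4 $$ (2, 0) = c3 - x / c2"
    "family_mat c2 c3 c4 x m n b4 $$ (2, 1) = x / c2"
    "family_mat c2 c3 c4 x m n b4 $$ (3, 0) = c4 - (n + m) / b4"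
    "family_mat c2 c3 c4 x m n b4 $$ (3, 1) = n / b4"
    "family_mat c2 c3 c4 x m n b4 $$ (3, 2) = m / b4"
    by (simp_all add: family_mat_def)
  have b: "family_vec b2 b3 b4 $ 0 = 1 - b2 - b3 - b4" "family_vec b2 b3 b4 $ 1 = b2"
    "family_vec b2 b3 b4 $ 2 = b3" "family_vec b2 b3 b4 $ 3 = b4"
    by (simp_all add: family_vec_def)
  have c: "c2 = c2" "c3 = (c3 - x / c2) + x / c2" "c4 = (c4 - (n + m) / b4) + n / b4 + m / b4"
    by (simp_all add: add_divide_distrib)
  note w = explicit_weights[OF rk_method_family rk_explicit_family, OF A(1-6)[symmetric] b[symmetric] c]
  have nm: "b4 * (n / b4 * c2 + m / b4 * c3) = n * c2 + m * c3"
    "b4 * c4 * (n / b4 * c2 + m / b4 * c3) = c4 * (n * c2 + m * c3)"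
    "b4 * (n / b4 * c2 ^ 2 + m / b4 * c3 ^ 2) = n * c2 ^ 2 + m * c3 ^ 2"
    "b4 * (m / b4) = m" "x / c2 * c2 = x" "x / c2 * c2 ^ 2 = x * c2"
    using assms by (simp_all add: field_simps power2_eq_square)
  have x: "b3 * (x / c2) * c2 = b3 * x" "b3 * c3 * (x / c2) * c2 = b3 * c3 * x"
    "b3 * (x / c2) * c2 ^ 2 = b3 * x * c2"
    using assms by (simp_all add: power2_eq_square)
  show "\<alpha> (Some t1) = 1"
    "\<alpha> (Some t2) = b2 * c2 + b3 * c3 + b4 * c4"
    "\<alpha> (Some t3) = b2 * c2 ^ 2 + b3 * c3 ^ 2 + b4 * c4 ^ 2"
    "\<alpha> (Some t4) = b3 * x + n * c2 + m * c3"
    "\<alpha> (Some t5) = b2 * c2 ^ 3 + b3 * c3 ^ 3 + b4 * c4 ^ 3"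
    "\<alpha> (Some t6) = b3 * c3 * x + c4 * (n * c2 + m * c3)"
    "\<alpha> (Some t7) = b3 * x * c2 + n * c2 ^ 2 + m * c3 ^ 2"
    "\<alpha> (Some t8) = m * x"
    unfolding \<alpha>_def w nm x using assms by simp_all
qed

text \<open>Hypothesis \<open>b3\<close> is \<open>combination\<close> of
  \<open>effective_order_4I\<close> with b2 and n eliminated by \<open>e2\<close> and
  \<open>e4\<close>, multiplied by 12 m so that 24 m x = 1 removes x. Given the abscissae, m and b4,
  it is linear in b3.\<close>

lemma order_2_family:
  assumes pos: "0 < c2" "0 < b4" and x: "24 * m * x = 1"
    and e2: "b2 * c2 + b3 * c3 + b4 * c4 = 1 / 2" and e4: "b3 * x + n * c2 + m * c3 = 1 / 6"
    and b3: "b3 * (12 * m * c3 * (c3 - c2) * (c3 + c2 - 1) + (c4 - c3)) =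
      12 * m * (- 1 / 4 + (2 * c4 - c2) / 6 - m * c3 * (c3 - c2) - (c2 ^ 2 - c2) / 2
      - b4 * c4 * (c4 - c2) * (c4 + c2 - 1))"
  shows "effective_order 4 (family_mat c2 c3 c4 x m n b4) (family_vec b2 b3 b4)"
    "classical_order 2 (family_mat c2 c3 c4 x m n b4) (family_vec b2 b3 b4)"
proof -
  note w = family_weights[OF pos]
  have m: "m \<noteq> 0" using x by auto
  have "12 * m * (b3 * (c3 * (c3 - c2) * (c3 + c2 - 1) + 2 * x * (c4 - c3))) =
    b3 * (12 * m * c3 * (c3 - c2) * (c3 + c2 - 1) + 24 * m * x * (c4 - c3))"
    by (simp add: algebra_simps)
  also have "\<dots> = 12 * m * (- 1 / 4 + (2 * c4 - c2) / 6 - m * c3 * (c3 - c2) - (c2 ^ 2 - c2) / 2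
      - b4 * c4 * (c4 - c2) * (c4 + c2 - 1))"
    using b3 unfolding x by simp
  finally have e5: "b3 * (c3 * (c3 - c2) * (c3 + c2 - 1) + 2 * x * (c4 - c3)) =
    - 1 / 4 + (2 * c4 - c2) / 6 - m * c3 * (c3 - c2) - (c2 ^ 2 - c2) / 2
      - b4 * c4 * (c4 - c2) * (c4 + c2 - 1)"
    using m by simp
  \<comment> \<open>The multipliers of \<open>e2\<close> and \<open>e4\<close> are those that cancel
    b2 and n.\<close>
  have "1 / 4 - (b2 * c2 ^ 2 + b3 * c3 ^ 2 + b4 * c4 ^ 2) + (b2 * c2 ^ 3 + b3 * c3 ^ 3 + b4 * c4 ^ 3)
      - 2 * (b3 * c3 * x + c4 * (n * c2 + m * c3)) + (b3 * x * c2 + n * c2 ^ 2 + m * c3 ^ 2) =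
    (b3 * (c3 * (c3 - c2) * (c3 + c2 - 1) + 2 * x * (c4 - c3))
       - (- 1 / 4 + (2 * c4 - c2) / 6 - m * c3 * (c3 - c2) - (c2 ^ 2 - c2) / 2
          - b4 * c4 * (c4 - c2) * (c4 + c2 - 1)))
    + (c2 ^ 2 - c2) * ((b2 * c2 + b3 * c3 + b4 * c4) - 1 / 2)
    + (c2 - 2 * c4) * ((b3 * x + n * c2 + m * c3) - 1 / 6)"
    by (simp add: algebra_simps power2_eq_square power3_eq_cube diff_divide_distrib add_divide_distrib)
  also have "\<dots> = 0" unfolding e2 e4 e5 by simp
  finally have combination: "1 / 4 - (b2 * c2 ^ 2 + b3 * c3 ^ 2 + b4 * c4 ^ 2)
      + (b2 * c2 ^ 3 + b3 * c3 ^ 3 + b4 * c4 ^ 3)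
      - 2 * (b3 * c3 * x + c4 * (n * c2 + m * c3)) + (b3 * x * c2 + n * c2 ^ 2 + m * c3 ^ 2) = 0" .
  show "effective_order 4 (family_mat c2 c3 c4 x m n b4) (family_vec b2 b3 b4)"
    by (rule effective_order_4I, unfold w) (rule refl e2 e4 combination | use x in simp)+
  show "classical_order 2 (family_mat c2 c3 c4 x m n b4) (family_vec b2 b3 b4)"
    unfolding classical_order_def all_tree_size_le_4 w exact_evolution_trees using e2 by simp
qed

text \<open>Order three adds the condition at \<open>t3\<close>, which becomes \<open>b4\<close>
  after elimination of b2. Substituting it into the equation for b3 of \<open>order_2_family\<close>
  removes b4 and leaves \<open>b3\<close>.\<close>

lemma order_3_family:
  assumes pos: "0 < c2" "0 < b4" and x: "24 * m * x = 1"
    and e2: "b2 * c2 + b3 * c3 + b4 * c4 = 1 / 2" and e4: "b3 * x + n * c2 + m * c3 = 1 / 6"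
    and b3: "b3 * ((c4 - c3) * (1 - 12 * m * c3 * (c3 - c2))) =
      m * (1 - 6 * c2 * (1 - c4) - 12 * m * c3 * (c3 - c2))"
    and b4: "b4 * (c4 * (c4 - c2)) = 1 / 3 - c2 / 2 - b3 * (c3 * (c3 - c2))"
  shows "effective_order 4 (family_mat c2 c3 c4 x m n b4) (family_vec b2 b3 b4)"
    "classical_order 3 (family_mat c2 c3 c4 x m n b4) (family_vec b2 b3 b4)"
proof -
  have b4': "b4 * c4 * (c4 - c2) * (c4 + c2 - 1) =
    (1 / 3 - c2 / 2 - b3 * (c3 * (c3 - c2))) * (c4 + c2 - 1)"
    unfolding b4[symmetric] by (simp add: mult.assoc)
  have "b3 * (12 * m * c3 * (c3 - c2) * (c3 + c2 - 1) + (c4 - c3)) =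
      12 * m * (- 1 / 4 + (2 * c4 - c2) / 6 - m * c3 * (c3 - c2) - (c2 ^ 2 - c2) / 2
      - (1 / 3 - c2 / 2 - b3 * (c3 * (c3 - c2))) * (c4 + c2 - 1))
    + (b3 * ((c4 - c3) * (1 - 12 * m * c3 * (c3 - c2)))
      - m * (1 - 6 * c2 * (1 - c4) - 12 * m * c3 * (c3 - c2)))"
    by (simp add: algebra_simps power2_eq_square diff_divide_distrib add_divide_distrib)
  then have "b3 * (12 * m * c3 * (c3 - c2) * (c3 + c2 - 1) + (c4 - c3)) =
      12 * m * (- 1 / 4 + (2 * c4 - c2) / 6 - m * c3 * (c3 - c2) - (c2 ^ 2 - c2) / 2
      - b4 * c4 * (c4 - c2) * (c4 + c2 - 1))"
    unfolding b3 b4' by simp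
  note 2 = order_2_family[OF pos x e2 e4 this]
  show "effective_order 4 (family_mat c2 c3 c4 x m n b4) (family_vec b2 b3 b4)" by (rule 2(1))
  have "b2 * c2 ^ 2 + b3 * c3 ^ 2 + b4 * c4 ^ 2 =
    c2 * (b2 * c2 + b3 * c3 + b4 * c4) + b3 * (c3 * (c3 - c2)) + b4 * (c4 * (c4 - c2))"
    by (simp add: algebra_simps power2_eq_square)
  then have "b2 * c2 ^ 2 + b3 * c3 ^ 2 + b4 * c4 ^ 2 = 1 / 3"
    unfolding e2 b4 by simp
  then show "classical_order 3 (family_mat c2 c3 c4 x m n b4) (family_vec b2 b3 b4)"
    unfolding classical_order_def all_tree_size_le_4 family_weights[OF pos] exact_evolution_trees
    using e2 e4 by simp
qed

section \<open>Positivity and printed values for the family\<close>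

lemma ssp_coefficient_family_pos:
  assumes "0 < c2" "0 < c3 - x / c2" "0 < x / c2" "0 < c4 - (n + m) / b4" "0 < n / b4" "0 < m / b4"
    "0 < 1 - b2 - b3 - b4" "0 < b2" "0 < b3" "0 < b4"
  shows "0 < ssp_coefficient (family_mat c2 c3 c4 x m n b4) (family_vec b2 b3 b4)"
  by (rule ssp_coefficient_pos_if_coefficients_pos[OF rk_method_family rk_explicit_family
        refl refl refl refl refl refl refl refl refl refl])
     (use assms in \<open>simp_all add: family_mat_def family_vec_def\<close>)

lemma tableau_within_family:
  assumes "\<bar>c2 - p21\<bar> \<le> e" "\<bar>c3 - x / c2 - p31\<bar> \<le> e" "\<bar>x / c2 - p32\<bar> \<le> e"
    "\<bar>c4 - (n + m) / b4 - p41\<bar> \<le> e" "\<bar>n / b4 - p42\<bar> \<le> e" "\<bar>m / b4 - p43\<bar> \<le> e"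
    "\<bar>1 - b2 - b3 - b4 - q1\<bar> \<le> e" "\<bar>b2 - q2\<bar> \<le> e" "\<bar>b3 - q3\<bar> \<le> e" "\<bar>b4 - q4\<bar> \<le> e"
    "\<bar>c3 - r3\<bar> \<le> e" "\<bar>c4 - r4\<bar> \<le> e"
  shows "tableau_within e (family_mat c2 c3 c4 x m n b4) (family_vec b2 b3 b4)
    [[0, 0, 0, 0], [p21, 0, 0, 0], [p31, p32, 0, 0], [p41, p42, p43, 0]]
    [q1, q2, q3, q4] [0, p21, r3, r4]"
proof -
  have dims: "dim_vec (family_vec b2 b3 b4) = 4" "dim_col (family_mat c2 c3 c4 x m n b4) = 4"
    by (simp_all add: family_mat_def family_vec_def)
  have e: "0 \<le> e" using assms(1) by linarith
  show ?thesis
    unfolding tableau_within_def dims all_less_4 abscissa_def sum_lessThan_4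
    using assms e by (simp add: family_mat_def family_vec_def add_divide_distrib)
qed

text \<open>With numerals for c, d, e the cleared bounds are linear in n and b, within reach of
  linear arithmetic.\<close>

lemma abs_divide_diff_le_iff:
  fixes b :: real
  assumes "0 < b"
  shows "\<bar>n / b - d\<bar> \<le> e \<longleftrightarrow> d * b - e * b \<le> n \<and> n \<le> d * b + e * b"
    "\<bar>c - n / b - d\<bar> \<le> e \<longleftrightarrow> c * b - d * b - e * b \<le> n \<and> n \<le> c * b - d * b + e * b"
  using assms by (auto simp: abs_le_iff field_simps)

text \<open>Decimal literals are fractions over these powers, which linear arithmetic needs as
  numerals.\<close>

lemma ten_powers:
  "(10::real) ^ 15 = 1000000000000000" "(10::real) ^ 16 = 10000000000000000"
  "(10::real) ^ 17 = 100000000000000000" "(10::real) ^ 20 = 100000000000000000000"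
  "(10::real) ^ 21 = 1000000000000000000000"
  by simp_all

lemma abs_diff_le_imp_pos:
  fixes y :: real
  shows "\<bar>y - d\<bar> \<le> e \<Longrightarrow> e < d \<Longrightarrow> 0 < y"
  by linarith

text \<open>In the following two proofs, the decimal parameters minimize the largest deviation from the
  printed values, up to rounding; the other quantities are determined by the order conditions.\<close>

lemma essprk442_exists:
  "\<exists>A b. rk_method 4 A b \<and> rk_explicit A \<and> 0 < ssp_coefficient A b \<and>
     effective_order 4 A b \<and> classical_order 2 A b \<and> essprk442 A b"
proof -
  define c2 c3 c4 m :: real where "c2 = 0.73042988578331859" and "c3 = 0.644964638145795"
    and "c4 = 0.99999999999999959" and "m = 0.14510084041508419"
  define x where "x = 1 / (24 * m)"
  define b4 :: real where "b4 = 0.22717303560443838"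
  define N where "N = 12 * m * (- 1 / 4 + (2 * c4 - c2) / 6 - m * c3 * (c3 - c2) - (c2 ^ 2 - c2) / 2
      - b4 * c4 * (c4 - c2) * (c4 + c2 - 1))"
  define D where "D = 12 * m * c3 * (c3 - c2) * (c3 + c2 - 1) + (c4 - c3)"
  define b3 where "b3 = N / D"
  define b2 where "b2 = (1 / 2 - b3 * c3 - b4 * c4) / c2"
  define n where "n = (1 / 6 - m * c3 - b3 * x) / c2"
  \<comment> \<open>The exact fractions show that D is nonzero and enclose b3 between neighbouring
    21-digit decimals.\<close>
  have N: "N =
    253710307367719274995042745664063681379178847451582079551827125104004496021213587 /
    6250000000000000000000000000000000000000000000000000000000000000000000000000000000"
    by (simp add: N_def c2_def c3_def c4_def m_def b4_def power2_eq_square)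
  have D: "D =
    15950266831074590448815802881982278685420974927907639658959096697 /
    50000000000000000000000000000000000000000000000000000000000000000"
    by (simp add: D_def c2_def c3_def c4_def m_def b4_def)
  have x: "24 * m * x = 1" "x = 12500000000000000 / 43530252124525257"
    by (simp_all add: x_def m_def)
  have pos: "0 < c2" "0 < c3" "0 < c4" "0 < x" "0 < m"
    by (simp_all add: c2_def c3_def c4_def x m_def)
  have b3: "0.127250689937518231721 \<le> b3" "b3 \<le> 0.127250689937518231722"
    unfolding b3_def N D by simp_all
  have b4: "0 < b4" by (simp add: b4_def)
  note b4_bounds = b4_def[unfolded ten_powers]
  have b3_eq: "b3 * (12 * m * c3 * (c3 - c2) * (c3 + c2 - 1) + (c4 - c3)) =
    12 * m * (- 1 / 4 + (2 * c4 - c2) / 6 - m * c3 * (c3 - c2) - (c2 ^ 2 - c2) / 2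
      - b4 * c4 * (c4 - c2) * (c4 + c2 - 1))"
    unfolding b3_def N_def[symmetric] D_def[symmetric] by (simp add: D)
  have e2: "b2 * c2 + b3 * c3 + b4 * c4 = 1 / 2" and e4: "b3 * x + n * c2 + m * c3 = 1 / 6"
    using pos by (simp_all add: b2_def n_def)
  \<comment> \<open>With numerals inserted, both equations are linear in the b's and n, so the
    narrow bounds on b3 and b4 carry over to b2 and n.\<close>
  note e2' = e2[unfolded c2_def c3_def c4_def ten_powers]
    and e4' = e4[unfolded c2_def c3_def m_def x(2) ten_powers]
  note order = order_2_family[OF pos(1) b4 x(1) e2 e4 b3_eq]
  have e: "1 / 2 / 10 ^ 15 = (0.0000000000000005 :: real)" by simp
  have b: "\<bar>1 - b2 - b3 - b4 - 0.384422161080494\<bar> \<le> 0.0000000000000005"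
    "\<bar>b2 - 0.261154113377550\<bar> \<le> 0.0000000000000005"
    "\<bar>b3 - 0.127250689937518\<bar> \<le> 0.0000000000000005"
    "\<bar>b4 - 0.227173035604438\<bar> \<le> 0.0000000000000005"
    using e2' b3 b4_bounds unfolding abs_le_iff ten_powers by linarith+
  have c: "\<bar>c2 - 0.730429885783319\<bar> \<le> 0.0000000000000005"
    "\<bar>c3 - 0.644964638145795\<bar> \<le> 0.0000000000000005"
    "\<bar>c4 - 1.000000000000000\<bar> \<le> 0.0000000000000005"
    by (simp_all add: c2_def c3_def c4_def abs_le_iff)
  have a3: "\<bar>c3 - x / c2 - 0.251830917810810\<bar> \<le> 0.0000000000000005"
    "\<bar>x / c2 - 0.393133720334985\<bar> \<le> 0.0000000000000005"
    unfolding abs_le_iff c3_def c2_def x(2) by simp_all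
  have n: "0.05002653715033010514 \<le> n" "n \<le> 0.05002653715033010517"
    using e4' b3 unfolding ten_powers by linarith+
  have a4: "\<bar>c4 - (n + m) / b4 - 0.141062771617064\<bar> \<le> 0.0000000000000005"
    "\<bar>n / b4 - 0.220213358584678\<bar> \<le> 0.0000000000000005"
    "\<bar>m / b4 - 0.638723869798257\<bar> \<le> 0.0000000000000005"
    using n b4_bounds unfolding abs_divide_diff_le_iff[OF b4] c4_def m_def ten_powers
    by linarith+
  have "essprk442 (family_mat c2 c3 c4 x m n b4) (family_vec b2 b3 b4)"
    unfolding essprk442_def e by (rule tableau_within_family[OF c(1) a3 a4 b c(2,3)])
  \<comment> \<open>A coefficient close to a printed value larger than the tolerance is
    positive.\<close>
  moreover have "0 < ssp_coefficient (family_mat c2 c3 c4 x m n b4) (family_vec b2 b3 b4)"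
    by (rule ssp_coefficient_family_pos)
       (rule pos b4 | (rule abs_diff_le_imp_pos, rule a3 a4 b, simp))+
  ultimately show ?thesis
    using rk_method_family rk_explicit_family order by blast
qed

lemma essprk443_exists:
  "\<exists>A b. rk_method 4 A b \<and> rk_explicit A \<and> 0 < ssp_coefficient A b \<and>
     effective_order 4 A b \<and> classical_order 3 A b \<and> essprk443 A b"
proof -
  define c2 c3 c4 m :: real where "c2 = 0.60124506876972316" and "c3 = 0.43688871988606396"
    and "c4 = 0.74776016375710904" and "m = 0.23291052399098252"
  define x where "x = 1 / (24 * m)"
  define N where "N = m * (1 - 6 * c2 * (1 - c4) - 12 * m * c3 * (c3 - c2))"
  define D where "D = (c4 - c3) * (1 - 12 * m * c3 * (c3 - c2))"
  define b3 where "b3 = N / D"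
  \<comment> \<open>Order three determines b4 as well; for order two it was a free decimal
    parameter.\<close>
  define b4 where "b4 = (1 / 3 - c2 / 2 - b3 * (c3 * (c3 - c2))) / (c4 * (c4 - c2))"
  define b2 where "b2 = (1 / 2 - b3 * c3 - b4 * c4) / c2"
  define n where "n = (1 / 6 - m * c3 - b3 * x) / c2"
  have N: "N =
    165325048191093572670886067713035773758802487550675745778406091 /
    2441406250000000000000000000000000000000000000000000000000000000"
    by (simp add: N_def c2_def c3_def c4_def m_def power2_eq_square)
  have D: "D =
    911280549212791227197038545335493573206984316589642116828263239 /
    2441406250000000000000000000000000000000000000000000000000000000"
    by (simp add: D_def c2_def c3_def c4_def m_def)
  have x: "24 * m * x = 1" "x = 3125000000000000 / 17468289299323689"
    by (simp_all add: x_def m_def)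
  have pos: "0 < c2" "0 < c3" "0 < c4" "0 < x" "0 < m"
    by (simp_all add: c2_def c3_def c4_def x m_def)
  have b3: "0.181420582644839118859 \<le> b3" "b3 \<le> 0.181420582644839118860"
    unfolding b3_def N D by simp_all
  have cc: "c4 * (c4 - c2) = 34236922318955016088783429911361 / 312500000000000000000000000000000"
    "c3 * (c3 - c2) = - 1121959919827018519743147656913 / 15625000000000000000000000000000"
    by (simp_all add: c2_def c3_def c4_def)
  have b4_eq: "b4 * (c4 * (c4 - c2)) = 1 / 3 - c2 / 2 - b3 * (c3 * (c3 - c2))"
    unfolding b4_def by (simp add: cc)
  \<comment> \<open>This is linear in b3 and b4, so the enclosure of b3 yields one of b4.\<close>
  note b4_eq' = b4_eq[unfolded cc, unfolded c2_def ten_powers]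
  have b4_bounds: "0.41747494080879087668 \<le> b4" "b4 \<le> 0.41747494080879087671"
    using b4_eq' b3 unfolding ten_powers by linarith+
  have b4: "0 < b4" using b4_bounds(1) by (rule less_le_trans[rotated]) simp
  have b3_eq: "b3 * ((c4 - c3) * (1 - 12 * m * c3 * (c3 - c2))) =
    m * (1 - 6 * c2 * (1 - c4) - 12 * m * c3 * (c3 - c2))"
    unfolding b3_def N_def[symmetric] D_def[symmetric] by (simp add: D)
  have e2: "b2 * c2 + b3 * c3 + b4 * c4 = 1 / 2" and e4: "b3 * x + n * c2 + m * c3 = 1 / 6"
    using pos by (simp_all add: b2_def n_def)
  note e2' = e2[unfolded c2_def c3_def c4_def ten_powers]
    and e4' = e4[unfolded c2_def c3_def m_def x(2) ten_powers]
  note order = order_3_family[OF pos(1) b4 x(1) e2 e4 b3_eq b4_eq]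
  have b: "\<bar>1 - b2 - b3 - b4 - 0.220532078662434\<bar> \<le> 0.000000000000001"
    "\<bar>b2 - 0.180572397883936\<bar> \<le> 0.000000000000001"
    "\<bar>b3 - 0.181420582644840\<bar> \<le> 0.000000000000001"
    "\<bar>b4 - 0.417474940808790\<bar> \<le> 0.000000000000001"
    using e2' b3 b4_bounds unfolding abs_le_iff ten_powers by linarith+
  have c: "\<bar>c2 - 0.601245068769724\<bar> \<le> 0.000000000000001"
    "\<bar>c3 - 0.436888719886063\<bar> \<le> 0.000000000000001"
    "\<bar>c4 - 0.747760163757110\<bar> \<le> 0.000000000000001"
    by (simp_all add: c2_def c3_def c4_def abs_le_iff)
  have a3: "\<bar>c3 - x / c2 - 0.139346829159954\<bar> \<le> 0.000000000000001"
    "\<bar>x / c2 - 0.297541890726109\<bar> \<le> 0.000000000000001"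
    unfolding abs_le_iff c3_def c2_def x(2) by simp_all
  have n: "0.05398022317677834515 \<le> n" "n \<le> 0.05398022317677834518"
    using e4' b3 unfolding ten_powers by linarith+
  have a4: "\<bar>c4 - (n + m) / b4 - 0.060555450075478\<bar> \<le> 0.000000000000001"
    "\<bar>n / b4 - 0.129301708677891\<bar> \<le> 0.000000000000001"
    "\<bar>m / b4 - 0.557903005003740\<bar> \<le> 0.000000000000001"
    using n b4_bounds unfolding abs_divide_diff_le_iff[OF b4] c4_def m_def ten_powers
    by linarith+
  have "essprk443 (family_mat c2 c3 c4 x m n b4) (family_vec b2 b3 b4)"
    unfolding essprk443_def by (rule tableau_within_family[OF c(1) a3 a4 b c(2,3)])
  moreover have "0 < ssp_coefficient (family_mat c2 c3 c4 x m n b4) (family_vec b2 b3 b4)"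
    by (rule ssp_coefficient_family_pos)
       (rule pos b4 | (rule abs_diff_le_imp_pos, rule a3 a4 b, simp))+
  ultimately show ?thesis
    using rk_method_family rk_explicit_family order by blast
qed

theorem mainTheorem5:
  shows "(\<nexists>A b. rk_method 4 A b \<and> rk_explicit A \<and> classical_order 4 A b \<and>
            0 < ssp_coefficient A b) \<and>
         (\<exists>A b. rk_method 4 A b \<and> rk_explicit A \<and> 0 < ssp_coefficient A b \<and>
            effective_order 4 A b \<and> classical_order 2 A b \<and> essprk442 A b) \<and>
         (\<exists>A b. rk_method 4 A b \<and> rk_explicit A \<and> 0 < ssp_coefficient A b \<and>
            effective_order 4 A b \<and> classical_order 3 A b \<and> essprk443 A b)"
  using no_explicit_ssp_order_4 essprk442_exists essprk443_exists by blast

end
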